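(* For all $n \geq 0$, $$p_{\xi}(8n+6) \equiv 0 \pmod{4}\qquad\text{and}\qquad p_{\xi}(16n+10) \equiv 0 \pmod{4}.$$
   Context: $(a;q)_n=(1-a)(1-aq)\cdots(1-aq^{n-1})$, $(a;q)_0=1$. The coefficients $p_\xi(n)$ are defined by $\sum_{n\ge0}p_\xi(n)q^n=\xi(q)=1+2\sum_{n\ge1}\frac{q^{6n^2-6n+1}}{(q;q^6)_n(q^5;q^6)_n}$. *)

theory Defs
  imports "HOL-Computational_Algebra.Computational_Algebra" "HOL-Number_Theory.Number_Theory"
begin

definition qpochhammer :: "'a::comm_ring_1 \<Rightarrow> 'a \<Rightarrow> nat \<Rightarrow> 'a" where
  "qpochhammer a q n = (\<Prod>k<n. 1 - a * q ^ k)"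

(* (q;q^6)_n (q^5;q^6)_n as a formal power series in the indeterminate q *)
definition xi_denom :: "nat \<Rightarrow> int fps" where
  "xi_denom n = qpochhammer fps_X (fps_X ^ 6) n * qpochhammer (fps_X ^ 5) (fps_X ^ 6) n"

(* int is not an instance of the class inverse, so inverse and / are unavailable on int fps.
   fps_right_inverse f y is the inverse of f built from an inverse y of its constant
   coefficient, here 1; see xi_denom_right_inverse. The subtraction in the exponent
   is never truncated, since n^2 >= n. *)
definition xi_summand :: "nat \<Rightarrow> int fps" where
  "xi_summand n = fps_X ^ (6 * n^2 - 6 * n + 1) * fps_right_inverse (xi_denom n) 1"

(* The infinite sum is taken in the X-adic topology on formal power series; it
   converges by summable_xi_summand. *)
definition xi :: "int fps" where
  "xi = 1 + 2 * (\<Sum>n. xi_summand (Suc n))"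

definition p_xi :: "nat \<Rightarrow> int" where
  "p_xi n = fps_nth xi n"

lemma fps_nth_0_qpochhammer:
  "fps_nth (qpochhammer a q n) 0 = (\<Prod>k<n. 1 - fps_nth a 0 * fps_nth q 0 ^ k)"
  for a q :: "'a::comm_ring_1 fps"
  by (induction n) (simp_all add: qpochhammer_def fps_nth_power_0)

lemma xi_denom_nth_0: "fps_nth (xi_denom n) 0 = 1"
  by (simp add: xi_denom_def fps_nth_0_qpochhammer)

lemma xi_denom_right_inverse: "xi_denom n * fps_right_inverse (xi_denom n) 1 = 1"
  by (rule fps_right_inverse) (simp add: xi_denom_nth_0)

lemma xi_summand_nth_eq_0:
  assumes "m < n"
  shows "fps_nth (xi_summand n) m = 0"
proof -
  have "n \<le> 6 * n^2 - 6 * n + 1"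
  proof (cases "n \<le> 1")
    case False
    then have "2 * n \<le> n^2" by (simp add: power2_eq_square)
    then show ?thesis by linarith
  qed auto
  with assms show ?thesis
    unfolding xi_summand_def fps_X_power_mult_nth by simp
qed

lemma xi_summand_sums:
  "(\<lambda>n. xi_summand (Suc n)) sums Abs_fps (\<lambda>m. \<Sum>n<m. fps_nth (xi_summand (Suc n)) m)"
  unfolding sums_def
proof (rule tendsto_fpsI)
  fix m :: nat
  have "fps_nth (\<Sum>n<N. xi_summand (Suc n)) m = (\<Sum>n<m. fps_nth (xi_summand (Suc n)) m)"
    if "m \<le> N" for N
    unfolding fps_sum_nth using that
    by (intro sum.mono_neutral_right) (auto simp: xi_summand_nth_eq_0)
  then show "\<forall>\<^sub>F N in sequentially. fps_nth (\<Sum>n<N. xi_summand (Suc n)) m =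
      fps_nth (Abs_fps (\<lambda>m. \<Sum>n<m. fps_nth (xi_summand (Suc n)) m)) m"
    by (auto intro: eventually_sequentiallyI)
qed

lemma summable_xi_summand: "summable (\<lambda>n. xi_summand (Suc n))"
  using xi_summand_sums by (rule sums_summable)

end

(* Modulo 4 only the parity of the coefficients of g = (xi - 1)/2 matters. With Q = q^6 and
   E = prod_{i>=1} (1 - Q^i), partial fractions and Bailey's lemma turn E g into a Lambert-type
   series, and Jacobi's identity gives E^3 = sum_s Q^(s(s+1)/2) mod 2. Hence the coefficient of q^i
   in E^4 g has the parity of the number of a b + 3 c^2 = 4(i+1) with a, b, c odd and
   0 < a < b, a = 1 mod 6, or 0 < a <= b, a = 5 mod 6. For i = 2 mod 4, involutions in the style
   of Zagier's proof of the two-square theorem show that this number is odd exactly when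
   i + 1 = 3 y^2, which is also the parity of the coefficient in
   q^2 sum_s q^(12 s(s+1)) = q^2 E^12 mod 2. Since E^4 is mod 2 a series in q^24, the terms
   of g with exponent 2 mod 4 agree mod 2 with q^2 E^8, a series with exponents 2 mod 48 only. *)
theory Submission
  imports Defs
begin

section \<open>Finite q-series identities\<close>

text \<open>The n-th summand has the denominator prod (1 + Q^(2r+1) - z Q^r) with z = q + q^5, which
  fits a Bailey pair relative to a = Q; Bailey's lemma costs one factor E. Parity cannot be read off
  from E g directly: E is a series in q^6, and division by it mixes the exponents 0 and 2 mod 4. The
  factor E^3 is the remedy. It raises E to E^4, so that division keeps the residues mod 4 apart, and
  it contributes the term 3 c^2 that makes the coefficients representation numbers. The comparison
  series is q^2 E^8 because E^4 E^8 is again a power of E^3. For i = 2 mod 4 put S = i + 1; then 4 S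
  - 3 c^2 with c odd, and S / 3 when it is an integer, are 1 mod 4, as Zagier's argument requires.
  His map is undefined on one line of solutions; the resulting terms for squares with root 3 mod 4,
  together with the degenerate representations 0^2 + 3 y^2, produce the exceptional values S = 3
  y^2. Infinite sums and products are truncated at N and compared modulo Q^(N+1).\<close>

text \<open>The type \<open>int fps\<close> has no \<open>inverse\<close>, so the inverses of \<open>1 - Q ^ n\<close> are a parameter.\<close>

locale qseries =
  fixes Q :: "'a::comm_ring_1" and iu :: "nat \<Rightarrow> 'a"
  assumes iu: "n > 0 \<Longrightarrow> (1 - Q ^ n) * iu n = 1"
begin

definition qpoch :: "nat \<Rightarrow> 'a" where "qpoch n = (\<Prod>i<n. 1 - Q ^ Suc i)"
definition qpoch_inv :: "nat \<Rightarrow> 'a" where "qpoch_inv n = (\<Prod>i<n. iu (Suc i))"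

lemma qpoch_inv_0 [simp]: "qpoch_inv 0 = 1"
  and qpoch_0 [simp]: "qpoch 0 = 1"
  by (simp_all add: qpoch_inv_def qpoch_def)

lemma qpoch_Suc: "qpoch (Suc n) = qpoch n * (1 - Q ^ Suc n)"
  by (simp add: qpoch_def)

lemma qpoch_inv_Suc: "(1 - Q ^ Suc n) * qpoch_inv (Suc n) = qpoch_inv n"
proof -
  have "(1 - Q ^ Suc n) * qpoch_inv (Suc n) = ((1 - Q ^ Suc n) * iu (Suc n)) * qpoch_inv n"
    by (simp only: qpoch_inv_def prod.lessThan_Suc mult_ac)
  then show ?thesis by (simp only: iu[OF zero_less_Suc] mult_1)
qed

lemma qpoch_mult_inv: "qpoch n * qpoch_inv n = 1"
proof (induction n)
  case (Suc n)
  have "qpoch (Suc n) * qpoch_inv (Suc n) = qpoch n * ((1 - Q ^ Suc n) * qpoch_inv (Suc n))"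
    by (simp only: qpoch_Suc mult.assoc)
  then show ?case by (simp only: qpoch_inv_Suc Suc)
qed simp

lemma unit_cancel:
  assumes "n > 0" "(1 - Q ^ n) * x = (1 - Q ^ n) * y"
  shows "x = y"
proof -
  have "(1 - Q ^ n) * iu n * x = (1 - Q ^ n) * iu n * y"
    using arg_cong[OF assms(2), of "\<lambda>t. iu n * t"] by (simp only: mult_ac)
  then show ?thesis by (simp only: iu[OF assms(1)] mult_1)
qed

text \<open>A finite q-Chu-Vandermonde sum; as M tends to infinity it sorts partitions by their
  Durfee rectangle of size m by m + k. Splitting 1 - Q^(M+1) as (1 - Q^(M+1-m)) + Q^(M+1-m) (1 -
  Q^m) cancels one denominator factor in each part. This yields the sum for \<open>k\<close> and,
  after a shift of m, the sum for \<open>k + 1\<close>; hence \<open>k\<close> varies in the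
  induction.\<close>

lemma durfee_rectangle:
  "(\<Sum>m\<le>M. Q ^ (m * (m + k)) * qpoch_inv m * qpoch_inv (M - m) * qpoch_inv (m + k)) = qpoch_inv M * qpoch_inv (M + k)"
proof (induction M arbitrary: k)
  case (Suc M)
  define t where "t m = Q ^ (m * (m + k)) * qpoch_inv m * qpoch_inv (Suc M - m) * qpoch_inv (m + k)" for m
  define t1 where "t1 m = Q ^ (m * (m + k)) * qpoch_inv m * qpoch_inv (M - m) * qpoch_inv (m + k)" for m
  define t2 where "t2 m = Q ^ (m * (m + Suc k)) * qpoch_inv m * qpoch_inv (M - m) * qpoch_inv (m + Suc k)" for m
  have split: "(1 - Q ^ Suc M) * t m =
      (if m \<le> M then t1 m else 0) + (if m > 0 then Q ^ (Suc M + k) * t2 (m - 1) else 0)"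
    if "m \<le> Suc M" for m
  proof -
    have "1 - Q ^ Suc M = (1 - Q ^ (Suc M - m)) + Q ^ (Suc M - m) * (1 - Q ^ m)"
      using that by (simp add: algebra_simps flip: power_add)
    then have "(1 - Q ^ Suc M) * t m =
        (1 - Q ^ (Suc M - m)) * t m + Q ^ (Suc M - m) * (1 - Q ^ m) * t m"
      by (simp add: algebra_simps)
    moreover have "(1 - Q ^ (Suc M - m)) * t m = (if m \<le> M then t1 m else 0)"
    proof (cases "m \<le> M")
      case True
      then have "qpoch_inv (M - m) = (1 - Q ^ (Suc M - m)) * qpoch_inv (Suc M - m)"
        using qpoch_inv_Suc[of "M - m"] by (simp add: Suc_diff_le)
      then show ?thesis using True by (simp only: t_def t1_def) (simp add: mult_ac)
    qed (use that in simp)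
    moreover have "Q ^ (Suc M - m) * (1 - Q ^ m) * t m =
        (if m > 0 then Q ^ (Suc M + k) * t2 (m - 1) else 0)"
    proof (cases m)
      case (Suc j)
      have e: "Suc M - m + m * (m + k) = Suc M + k + j * (j + Suc k)"
        using that Suc by (simp add: algebra_simps)
      have R_m: "(1 - Q ^ m) * qpoch_inv m = qpoch_inv j" using Suc qpoch_inv_Suc[of j] by simp
      have "Q ^ (Suc M - m) * (1 - Q ^ m) * t m =
          Q ^ (Suc M - m + m * (m + k)) * ((1 - Q ^ m) * qpoch_inv m) * qpoch_inv (Suc M - m) * qpoch_inv (m + k)"
        by (simp only: t_def power_add mult_ac)
      also have "\<dots> = Q ^ (Suc M + k) * t2 j"
        unfolding e t2_def power_add[of Q "Suc M + k"] R_m using Suc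
        by (simp add: mult_ac)
      finally show ?thesis using Suc by simp
    qed simp
    ultimately show ?thesis by simp
  qed
  have "(1 - Q ^ Suc M) * (\<Sum>m\<le>Suc M. t m) =
      (\<Sum>m\<le>Suc M. (if m \<le> M then t1 m else 0)) +
      (\<Sum>m\<le>Suc M. (if m > 0 then Q ^ (Suc M + k) * t2 (m - 1) else 0))"
    unfolding sum_distrib_left sum.distrib[symmetric] by (intro sum.cong refl split) simp
  also have "(\<Sum>m\<le>Suc M. (if m \<le> M then t1 m else 0)) = (\<Sum>m\<le>M. t1 m)"
    by simp
  also have "(\<Sum>m\<le>Suc M. (if m > 0 then Q ^ (Suc M + k) * t2 (m - 1) else 0)) =
      Q ^ (Suc M + k) * (\<Sum>m\<le>M. t2 m)"
    by (simp add: sum.atMost_Suc_shift sum_distrib_left del: sum.atMost_Suc)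
  also have "(\<Sum>m\<le>M. t1 m) = qpoch_inv M * qpoch_inv (M + k)"
    using Suc[of k] by (simp add: t1_def)
  also have "(\<Sum>m\<le>M. t2 m) = qpoch_inv M * qpoch_inv (M + Suc k)"
    using Suc[of "Suc k"] by (simp add: t2_def)
  also have "qpoch_inv M * qpoch_inv (M + k) + Q ^ (Suc M + k) * (qpoch_inv M * qpoch_inv (M + Suc k)) = qpoch_inv M * qpoch_inv (Suc M + k)"
  proof -
    have "qpoch_inv (M + k) = (1 - Q ^ (Suc M + k)) * qpoch_inv (Suc M + k)"
      using qpoch_inv_Suc[of "M + k"] by simp
    then show ?thesis by (simp only: add_Suc_shift[symmetric]) (simp add: left_diff_distrib right_diff_distrib mult_ac)
  qed
  also have "\<dots> = (1 - Q ^ Suc M) * (qpoch_inv (Suc M) * qpoch_inv (Suc M + k))"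
    using qpoch_inv_Suc[of M] by (simp only: mult.assoc[symmetric])
  finally show ?case
    using unit_cancel[of "Suc M"] unfolding t_def by blast
qed simp

section \<open>Partial fractions and Bailey's lemma at a = Q\<close>

text \<open>The Bailey kernel 1 / ((Q; Q)_(n-r) (aQ; Q)_(n+r)) at a = Q, up to the factor 1 - Q. The
  value 0 for \<open>r > n\<close> stands for the vanishing reciprocal at a negative index, which
  truncated subtraction would lose.\<close>

definition pair_inv :: "nat \<Rightarrow> nat \<Rightarrow> 'a" where
  "pair_inv n r = (if r \<le> n then qpoch_inv (n - r) * qpoch_inv (n + r + 1) else 0)"

lemma pair_inv_Suc:
  assumes "r \<le> Suc n"
  shows "(1 - Q ^ (Suc n - r)) * (1 - Q ^ (n + r + 2)) * pair_inv (Suc n) r = pair_inv n r"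
proof (cases "r \<le> n")
  case True
  have "qpoch_inv (n - r) = (1 - Q ^ (Suc n - r)) * qpoch_inv (Suc n - r)"
    using qpoch_inv_Suc[of "n - r"] True by (simp add: Suc_diff_le)
  moreover have "qpoch_inv (n + r + 1) = (1 - Q ^ (n + r + 2)) * qpoch_inv (n + r + 2)"
    using qpoch_inv_Suc[of "n + r + 1"] by simp
  ultimately have "pair_inv n r = (1 - Q ^ (Suc n - r)) * qpoch_inv (Suc n - r) * ((1 - Q ^ (n + r + 2)) * qpoch_inv (n + r + 2))"
    unfolding pair_inv_def using True by simp
  then show ?thesis using True unfolding pair_inv_def by (simp add: mult_ac)
qed (use assms in \<open>simp add: pair_inv_def\<close>)

text \<open>The full sum over \<open>r \<le> n\<close> vanishes because \<open>1 / (Q; Q)\<^sub>m\<close> does for \<open>m = - 1\<close>.\<close>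

lemma unit_pair_partial_sum:
  assumes "k \<le> n"
  shows "(1 - Q ^ n) * (\<Sum>r<k. (-1) ^ r * Q ^ (r * (r - 1) div 2) * (1 - Q ^ (2 * r + 1)) * pair_inv n r)
    = - ((-1) ^ k * Q ^ (k * (k - 1) div 2) * (1 - Q ^ k) * qpoch_inv (n - k) * qpoch_inv (n + k))"
  using assms
proof (induction k)
  case (Suc k)
  have tri: "Suc k * (Suc k - 1) div 2 = k * (k - 1) div 2 + k"
    by (cases k) (auto simp: algebra_simps)
  have a: "(1 - Q ^ (n - k)) * qpoch_inv (n - k) = qpoch_inv (n - Suc k)"
    using qpoch_inv_Suc[of "n - Suc k"] Suc.prems by (simp add: Suc_diff_Suc)
  have b: "(1 - Q ^ Suc (n + k)) * qpoch_inv (Suc (n + k)) = qpoch_inv (n + k)"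
    by (rule qpoch_inv_Suc)
  \<comment> \<open>This closes the telescoping: Q^k raises the triangular exponent, 1 - Q^(k+1) is
    the new factor of the closed form, and 1 - Q^(n-k) lowers the index of
    \<open>qpoch_inv (n - k)\<close>.\<close>
  have key: "(1 - Q ^ n) * (1 - Q ^ (2 * k + 1)) - (1 - Q ^ k) * (1 - Q ^ Suc (n + k)) =
      Q ^ k * (1 - Q ^ Suc k) * (1 - Q ^ (n - k))"
  proof -
    obtain m where m: "n = m + k" using Suc.prems by (metis le_add_diff_inverse2 Suc_leD)
    show ?thesis unfolding m by (simp add: algebra_simps power_add power_mult power2_eq_square)
  qed
  define E where "E = (-1) ^ k * Q ^ (k * (k - 1) div 2)"
  define x where "x = qpoch_inv (n - k)"
  define y where "y = qpoch_inv (Suc (n + k))"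
  have "(1 - Q ^ n) * (\<Sum>r<Suc k. (-1) ^ r * Q ^ (r * (r - 1) div 2) * (1 - Q ^ (2 * r + 1)) * pair_inv n r)
     = - (E * (1 - Q ^ k) * x * ((1 - Q ^ Suc (n + k)) * y)) + (1 - Q ^ n) * (E * (1 - Q ^ (2 * k + 1)) * (x * y))"
  proof -
    have "pair_inv n k = x * y" using Suc.prems by (simp add: pair_inv_def x_def y_def)
    then show ?thesis
      unfolding sum.lessThan_Suc distrib_left Suc.IH[OF Suc_leD[OF Suc.prems]]
      by (simp only: E_def x_def y_def b)
  qed
  also have "\<dots> = E * x * y * ((1 - Q ^ n) * (1 - Q ^ (2 * k + 1)) - (1 - Q ^ k) * (1 - Q ^ Suc (n + k)))"
    by (simp add: algebra_simps)
  also have "\<dots> = E * Q ^ k * (1 - Q ^ Suc k) * ((1 - Q ^ (n - k)) * x) * y"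
    unfolding key by (simp only: mult_ac)
  also have "(1 - Q ^ (n - k)) * x = qpoch_inv (n - Suc k)" using a by (simp add: x_def)
  also have "E * Q ^ k = - ((-1) ^ Suc k * Q ^ (Suc k * (Suc k - 1) div 2))"
    unfolding tri by (simp add: E_def power_add)
  finally show ?case by (simp add: y_def)
qed simp

text \<open>Orthogonality of the unit Bailey pair. At k = n the closed form of the partial sum is
  the negative of the term r = n, because 1 - Q^(2n+1) removes the last factor of
  \<open>qpoch_inv (2 * n + 1)\<close>. For n = 0 the sum is 1.\<close>

lemma unit_pair_sum:
  assumes "n > 0"
  shows "(\<Sum>r\<le>n. (-1) ^ r * Q ^ (r * (r - 1) div 2) * (1 - Q ^ (2 * r + 1)) * pair_inv n r) = 0"
proof (rule unit_cancel[OF assms])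
  have "(1 - Q ^ (2 * n + 1)) * qpoch_inv (2 * n + 1) = qpoch_inv (n + n)"
    using qpoch_inv_Suc[of "2 * n"] by (simp add: mult_2)
  then have last: "(1 - Q ^ (2 * n + 1)) * pair_inv n n = qpoch_inv (n + n)"
    by (simp add: pair_inv_def mult_2)
  show "(1 - Q ^ n) * (\<Sum>r\<le>n. (-1) ^ r * Q ^ (r * (r - 1) div 2) * (1 - Q ^ (2 * r + 1)) * pair_inv n r)
      = (1 - Q ^ n) * 0"
    unfolding lessThan_Suc_atMost[symmetric] sum.lessThan_Suc distrib_left
      unit_pair_partial_sum[OF order_refl]
    by (simp only: mult.assoc last) (simp add: mult_ac)
qed

lemma tri_add: "n + r * (r - 1) div 2 = n - r + r * (r + 1) div 2" if "r \<le> n" for n r :: nat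
proof -
  have "r * (r + 1) div 2 = r * (r - 1) div 2 + r"
    by (cases r) (auto simp: algebra_simps)
  then show ?thesis using that by simp
qed

text \<open>Induction on \<open>n\<close>: multiplication by the last denominator lowers \<open>n\<close> up to a multiple of the
  sum in \<open>unit_pair_sum\<close>.\<close>

lemma partial_fractions:
  assumes "\<And>r. (1 + Q ^ (2 * r + 1) - z * Q ^ r) * v r = 1"
  shows "(\<Sum>r\<le>n. (-1) ^ r * Q ^ (r * (r + 1) div 2) * (1 - Q ^ (2 * r + 1)) * pair_inv n r * v r) =
    (\<Prod>r\<le>n. v r)"
proof (induction n)
  case 0
  show ?case using qpoch_inv_Suc[of 0] by (simp add: pair_inv_def)
next
  case (Suc n)
  define c where "c r = (-1) ^ r * Q ^ (r * (r + 1) div 2) * (1 - Q ^ (2 * r + 1))" for r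
  define d where "d r = 1 + Q ^ (2 * r + 1) - z * Q ^ r" for r
  have dv: "d r * v r = 1" for r using assms[of r] by (simp add: d_def)
  have step: "d (Suc n) * (c r * pair_inv (Suc n) r * v r) = c r * pair_inv n r * v r +
      Q ^ Suc n * ((-1) ^ r * Q ^ (r * (r - 1) div 2) * (1 - Q ^ (2 * r + 1)) * pair_inv (Suc n) r)"
    if r: "r \<le> Suc n" for r
  proof -
    obtain m where m: "Suc n = m + r" using r by (metis le_add_diff_inverse2)
    \<comment> \<open>Subtracting Q^m times the r-th denominator removes z; what is left factors
      into exactly the two factors that \<open>pair_inv_Suc\<close> absorbs.\<close>
    have d: "d (Suc n) = Q ^ m * d r + (1 - Q ^ m) * (1 - Q ^ (m + 2 * r + 1))"
      unfolding m d_def by (simp add: algebra_simps power_add power_mult power2_eq_square)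
    have i: "Suc n - r = m" "n + r + 2 = m + 2 * r + 1" using m by simp_all
    have t: "(1 - Q ^ m) * (1 - Q ^ (m + 2 * r + 1)) * pair_inv (Suc n) r = pair_inv n r"
      using pair_inv_Suc[OF r] unfolding i .
    have "d (Suc n) * (c r * pair_inv (Suc n) r * v r) =
        Q ^ m * c r * pair_inv (Suc n) r * (d r * v r) +
        c r * ((1 - Q ^ m) * (1 - Q ^ (m + 2 * r + 1)) * pair_inv (Suc n) r) * v r"
      unfolding d by (simp add: algebra_simps)
    also have "\<dots> = c r * pair_inv n r * v r + Q ^ m * c r * pair_inv (Suc n) r"
      unfolding dv t by simp
    also have "Q ^ m * c r = Q ^ Suc n * ((-1) ^ r * Q ^ (r * (r - 1) div 2) * (1 - Q ^ (2 * r + 1)))"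
    proof -
      have "Q ^ m * Q ^ (r * (r + 1) div 2) = Q ^ Suc n * Q ^ (r * (r - 1) div 2)"
        by (simp only: power_add[symmetric] tri_add[OF r] i)
      from arg_cong[OF this, of "\<lambda>x. (-1) ^ r * (1 - Q ^ (2 * r + 1)) * x"]
      show ?thesis by (simp only: c_def mult_ac)
    qed
    finally show ?thesis by (simp add: mult.assoc)
  qed
  have "d (Suc n) * (\<Sum>r\<le>Suc n. c r * pair_inv (Suc n) r * v r) = (\<Sum>r\<le>Suc n. c r * pair_inv n r * v r) +
      Q ^ Suc n * (\<Sum>r\<le>Suc n. (-1) ^ r * Q ^ (r * (r - 1) div 2) * (1 - Q ^ (2 * r + 1)) * pair_inv (Suc n) r)"
    unfolding sum_distrib_left sum.distrib[symmetric] by (intro sum.cong refl step) simp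
  also have "\<dots> = (\<Sum>r\<le>Suc n. c r * pair_inv n r * v r)"
    by (simp only: unit_pair_sum[of "Suc n"] zero_less_Suc mult_zero_right add_0_right)
  also have "\<dots> = (\<Prod>r\<le>n. v r)"
    using Suc by (simp add: c_def pair_inv_def)
  finally have "v (Suc n) * d (Suc n) * (\<Sum>r\<le>Suc n. c r * pair_inv (Suc n) r * v r) = v (Suc n) * (\<Prod>r\<le>n. v r)"
    by (simp only: mult.assoc)
  then show ?case
    using dv[of "Suc n"] by (simp add: c_def mult.commute del: sum.atMost_Suc)
qed

lemma sum_triangle:
  fixes f :: "nat \<Rightarrow> nat \<Rightarrow> 'b::comm_monoid_add"
  shows "(\<Sum>n\<le>N. \<Sum>r\<le>n. f n r) = (\<Sum>r\<le>N. \<Sum>n=r..N. f n r)"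
proof -
  have "(\<Sum>n\<le>N. \<Sum>r\<le>n. f n r) = (\<Sum>n\<le>N. \<Sum>r\<in>{r \<in> {..N}. r \<le> n}. f n r)"
    by (intro sum.cong refl) auto
  also have "\<dots> = (\<Sum>r\<le>N. \<Sum>n\<in>{n \<in> {..N}. r \<le> n}. f n r)"
    by (rule sum.swap_restrict) simp_all
  also have "\<dots> = (\<Sum>r\<le>N. \<Sum>n=r..N. f n r)"
    by (intro sum.cong refl) auto
  finally show ?thesis .
qed

text \<open>Bailey's lemma with both free parameters sent to infinity. Expanding the product by
  \<open>partial_fractions\<close> and exchanging the sums, the inner sum over n = m + r is
  \<open>durfee_rectangle\<close> with M = N - r and k = 2 r + 1. It contributes Q^(r(r+1)), which
  turns the exponent r (r + 1) / 2 into three times itself.\<close>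

lemma bailey_finite:
  assumes "\<And>r. (1 + Q ^ (2 * r + 1) - z * Q ^ r) * v r = 1"
  shows "(\<Sum>n\<le>N. Q ^ (n * (n + 1)) * qpoch_inv (N - n) * (\<Prod>r\<le>n. v r)) =
    (\<Sum>r\<le>N. (-1) ^ r * Q ^ (3 * (r * (r + 1) div 2)) * (1 - Q ^ (2 * r + 1)) * v r * pair_inv N r)"
proof -
  define c where "c r = (-1) ^ r * Q ^ (r * (r + 1) div 2) * (1 - Q ^ (2 * r + 1))" for r
  have "(\<Sum>n\<le>N. Q ^ (n * (n + 1)) * qpoch_inv (N - n) * (\<Prod>r\<le>n. v r)) =
      (\<Sum>n\<le>N. \<Sum>r\<le>n. c r * v r * (Q ^ (n * (n + 1)) * qpoch_inv (N - n) * pair_inv n r))"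
    unfolding partial_fractions[OF assms, symmetric] c_def
    by (simp add: sum_distrib_left mult_ac)
  also have "\<dots> = (\<Sum>r\<le>N. \<Sum>n=r..N. c r * v r * (Q ^ (n * (n + 1)) * qpoch_inv (N - n) * pair_inv n r))"
    by (rule sum_triangle)
  also have "\<dots> = (\<Sum>r\<le>N. (-1) ^ r * Q ^ (3 * (r * (r + 1) div 2)) * (1 - Q ^ (2 * r + 1)) * v r * pair_inv N r)"
  proof (rule sum.cong[OF refl])
    fix r assume "r \<in> {..N}"
    then have r: "r \<le> N" by simp
    have "(\<Sum>n=r..N. Q ^ (n * (n + 1)) * qpoch_inv (N - n) * pair_inv n r) =
        (\<Sum>m\<le>N - r. Q ^ ((m + r) * (m + r + 1)) * qpoch_inv (N - (m + r)) * pair_inv (m + r) r)"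
      using r sum.shift_bounds_cl_nat_ivl[of "\<lambda>n. Q ^ (n * (n + 1)) * qpoch_inv (N - n) * pair_inv n r" 0 r "N - r"]
      by (simp add: atLeast0AtMost)
    also have "\<dots> = Q ^ (r * (r + 1)) *
        (\<Sum>m\<le>N - r. Q ^ (m * (m + (2 * r + 1))) * qpoch_inv m * qpoch_inv (N - r - m) * qpoch_inv (m + (2 * r + 1)))"
    proof -
      have "(m + r) * (m + r + 1) = r * (r + 1) + m * (m + (2 * r + 1))" for m
        by (simp add: algebra_simps)
      then show ?thesis
        unfolding sum_distrib_left pair_inv_def
        by (intro sum.cong) (simp_all add: power_add mult_2 mult_2_right add_ac mult_ac)
    qed
    also have "\<dots> = Q ^ (r * (r + 1)) * pair_inv N r"
      unfolding durfee_rectangle using r by (simp add: pair_inv_def mult_2)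
    finally have "(\<Sum>n=r..N. c r * v r * (Q ^ (n * (n + 1)) * qpoch_inv (N - n) * pair_inv n r)) =
        c r * v r * (Q ^ (r * (r + 1)) * pair_inv N r)"
      by (simp only: sum_distrib_left[symmetric])
    moreover have "3 * (r * (r + 1) div 2) = r * (r + 1) div 2 + r * (r + 1)"
    proof -
      have "2 * (r * (r + 1) div 2) = r * (r + 1)" by simp
      then show ?thesis by linarith
    qed
    ultimately show "(\<Sum>n=r..N. c r * v r * (Q ^ (n * (n + 1)) * qpoch_inv (N - n) * pair_inv n r)) =
        (-1) ^ r * Q ^ (3 * (r * (r + 1) div 2)) * (1 - Q ^ (2 * r + 1)) * v r * pair_inv N r"
      by (simp only: c_def power_add mult_ac)
  qed
  finally show ?thesis .
qed

section \<open>A finite form of Jacobi's identity for the cube of the Euler product\<close>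

text \<open>Up to (Q; Q)_(2n+1) the kernel is the Gaussian binomial of 2 n + 1 over n - r, and this
  is Pascal's rule applied twice. The kernel is symmetric under r -> -1 - r, so at r = 0 the
  neighbour at -1 is \<open>pair_inv m 0\<close>.\<close>

lemma pair_inv_three_term:
  assumes "r \<le> Suc m"
  shows "(1 - Q ^ (2 * m + 2)) * (1 - Q ^ (2 * m + 3)) * pair_inv (Suc m) r =
    (if r > 0 then Q ^ (Suc m - r) * pair_inv m (r - 1) else Q ^ Suc m * pair_inv m 0) +
    (1 + Q ^ (2 * m + 2)) * pair_inv m r + Q ^ (m + r + 2) * pair_inv m (r + 1)"
proof -
  obtain p where p: "Suc m = p + r" using assms by (metis le_add_diff_inverse2)
  have q: "Suc m - r = p" using p by simp
  define x where "x = qpoch_inv p"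
  define y where "y = qpoch_inv (m + r + 2)"
  have T0: "pair_inv (Suc m) r = x * y"
    using assms by (simp add: pair_inv_def q x_def y_def)
  have T1: "pair_inv m r = (1 - Q ^ p) * (1 - Q ^ (m + r + 2)) * (x * y)"
    using pair_inv_Suc[OF assms] unfolding q T0 by simp
  have R2: "qpoch_inv (m + r) = (1 - Q ^ (m + r + 1)) * (1 - Q ^ (m + r + 2)) * y"
    using qpoch_inv_Suc[of "m + r"] qpoch_inv_Suc[of "m + r + 1"] by (simp add: y_def mult.assoc)
  have T2: "(if r > 0 then Q ^ (Suc m - r) * pair_inv m (r - 1) else Q ^ Suc m * pair_inv m 0) =
      Q ^ p * ((1 - Q ^ (m + r + 1)) * (1 - Q ^ (m + r + 2)) * (x * y))"
  proof (cases r)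
    case 0
    then show ?thesis using p qpoch_inv_Suc[of m] R2
      by (simp add: pair_inv_def x_def)
  next
    case (Suc j)
    have "m - j = p" using Suc p by simp
    moreover have "Suc (m + j) = m + r" using Suc by simp
    ultimately show ?thesis using p Suc R2 by (simp add: pair_inv_def x_def mult_ac)
  qed
  \<comment> \<open>For p <= 1 both sides vanish: r + 1 > m on the left, and an exponent p or p - 1
    equal to 0 on the right.\<close>
  have T3: "pair_inv m (r + 1) = (1 - Q ^ p) * (1 - Q ^ (p - 1)) * (x * y)"
  proof (cases "p \<le> 1")
    case True
    then show ?thesis using p by (cases p) (auto simp: pair_inv_def)
  next
    case False
    define k where "k = p - 2"
    have k: "p = Suc (Suc k)" using False by (simp add: k_def)
    have "qpoch_inv k = (1 - Q ^ (p - 1)) * ((1 - Q ^ p) * qpoch_inv p)"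
      using qpoch_inv_Suc[of k] qpoch_inv_Suc[of "Suc k"] by (simp add: k)
    moreover have "m - Suc r = k" "Suc r \<le> m" using p k by auto
    ultimately show ?thesis by (simp add: pair_inv_def x_def y_def mult_ac)
  qed
  have "(1 - Q ^ (2 * m + 2)) * (1 - Q ^ (2 * m + 3)) =
      Q ^ p * ((1 - Q ^ (m + r + 1)) * (1 - Q ^ (m + r + 2))) +
      (1 + Q ^ (2 * m + 2)) * ((1 - Q ^ p) * (1 - Q ^ (m + r + 2))) +
      Q ^ (m + r + 2) * ((1 - Q ^ p) * (1 - Q ^ (p - 1)))"
  proof (cases p)
    case 0
    then have "2 * m + 2 = m + r + 1" "2 * m + 3 = m + r + 2" using p by simp_all
    then show ?thesis using 0 by (simp only:) simp
  next
    case (Suc k)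
    then have "m = k + r" using p by simp
    then show ?thesis using Suc
      by (simp add: algebra_simps power_add power_mult power2_eq_square power3_eq_cube)
  qed
  then show ?thesis
    unfolding T0 T1 T2 T3 by (simp only: distrib_right mult.assoc)
qed

text \<open>Summation by parts in \<open>pair_inv_three_term\<close> moves the shifts of r onto the
  weights \<open>w\<close>. These are an eigenvector of the resulting operator: \<open>coeff\<close>
  gives the eigenvalue (1 - Q^(m+1))^2, the square of the new factor of
  \<open>qpoch (Suc m)\<close>. At r = 0 the reflected neighbour supplies the missing term w (-1) =
  w 0.\<close>

lemma jacobi_cube_finite:
  "(\<Sum>r\<le>n. (-1) ^ r * of_nat (2 * r + 1) * Q ^ (r * (r + 1) div 2) * pair_inv n r) =
    qpoch n ^ 2 * qpoch_inv (2 * n + 1)"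
proof (induction n)
  case 0
  show ?case by (simp add: pair_inv_def)
next
  case (Suc m)
  define w where "w r = (-1) ^ r * of_nat (2 * r + 1) * Q ^ (r * (r + 1) div 2)" for r
  define J where "J n = (\<Sum>r\<le>n. w r * pair_inv n r)" for n
  have tri: "Suc r * (Suc r + 1) div 2 = r * (r + 1) div 2 + Suc r" for r
    by (simp add: algebra_simps)
  have w_Suc: "w (Suc r) = - ((-1) ^ r * of_nat (2 * r + 3) * Q ^ (r * (r + 1) div 2) * Q ^ Suc r)" for r
    unfolding w_def tri by (simp add: power_add mult_ac add_ac)
  have zero: "pair_inv m (Suc m) = 0" "pair_inv m (Suc (Suc m)) = 0" by (simp_all add: pair_inv_def)
  have coeff: "w (Suc r) * Q ^ (m - r) + w r * (1 + Q ^ (2 * m + 2)) +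
      (if r > 0 then w (r - 1) * Q ^ (m + r + 1) else w 0 * Q ^ Suc m) = (1 - Q ^ Suc m)\<^sup>2 * w r"
    if r: "r \<le> m" for r
  proof -
    obtain p where p: "m = p + r" using r by (metis le_add_diff_inverse2)
    show ?thesis
    proof (cases r)
      case 0
      then show ?thesis unfolding w_Suc w_def
        by (simp add: algebra_simps power2_eq_square power_add power_mult)
    next
      case (Suc j)
      have m: "m = p + Suc j" using p Suc by simp
      show ?thesis unfolding w_Suc tri Suc diff_Suc_1 w_def[of j] unfolding m
        by (simp add: algebra_simps power2_eq_square power_add power_mult)
    qed
  qed
  have "(1 - Q ^ (2 * m + 2)) * ((1 - Q ^ (2 * m + 3)) * J (Suc m)) =
      (\<Sum>r\<le>Suc m. w r * ((1 - Q ^ (2 * m + 2)) * (1 - Q ^ (2 * m + 3)) * pair_inv (Suc m) r))"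
    unfolding J_def sum_distrib_left by (intro sum.cong) (simp_all add: mult_ac)
  also have "\<dots> = (\<Sum>r\<le>Suc m. w r * (if r > 0 then Q ^ (Suc m - r) * pair_inv m (r - 1) else Q ^ Suc m * pair_inv m 0)) +
      (\<Sum>r\<le>Suc m. w r * ((1 + Q ^ (2 * m + 2)) * pair_inv m r)) +
      (\<Sum>r\<le>Suc m. w r * (Q ^ (m + r + 2) * pair_inv m (r + 1)))"
    unfolding sum.distrib[symmetric] by (intro sum.cong refl, simp only: pair_inv_three_term atMost_iff distrib_left)
  also have "(\<Sum>r\<le>Suc m. w r * (if r > 0 then Q ^ (Suc m - r) * pair_inv m (r - 1) else Q ^ Suc m * pair_inv m 0)) =
      w 0 * Q ^ Suc m * pair_inv m 0 + (\<Sum>r\<le>m. w (Suc r) * Q ^ (m - r) * pair_inv m r)"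
    by (simp add: sum.atMost_Suc_shift mult.assoc del: sum.atMost_Suc)
  also have "(\<Sum>r\<le>Suc m. w r * ((1 + Q ^ (2 * m + 2)) * pair_inv m r)) =
      (\<Sum>r\<le>m. w r * (1 + Q ^ (2 * m + 2)) * pair_inv m r)"
    by (simp add: zero mult.assoc)
  also have "(\<Sum>r\<le>Suc m. w r * (Q ^ (m + r + 2) * pair_inv m (r + 1))) =
      (\<Sum>r\<le>m. (if r > 0 then w (r - 1) * Q ^ (m + r + 1) else 0) * pair_inv m r)"
  proof -
    have "(\<Sum>r\<le>m. (if r > 0 then w (r - 1) * Q ^ (m + r + 1) else 0) * pair_inv m r) =
        (\<Sum>r\<le>Suc (Suc m). (if r > 0 then w (r - 1) * Q ^ (m + r + 1) else 0) * pair_inv m r)"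
      by (simp add: zero)
    also have "\<dots> = (\<Sum>r\<le>Suc m. w r * (Q ^ (m + r + 2) * pair_inv m (r + 1)))"
      by (subst sum.atMost_Suc_shift) (simp add: mult.assoc)
    finally show ?thesis by simp
  qed
  also have "w 0 * Q ^ Suc m * pair_inv m 0 + (\<Sum>r\<le>m. w (Suc r) * Q ^ (m - r) * pair_inv m r) +
      (\<Sum>r\<le>m. w r * (1 + Q ^ (2 * m + 2)) * pair_inv m r) +
      (\<Sum>r\<le>m. (if r > 0 then w (r - 1) * Q ^ (m + r + 1) else 0) * pair_inv m r) =
      (\<Sum>r\<le>m. (w (Suc r) * Q ^ (m - r) + w r * (1 + Q ^ (2 * m + 2)) +
        (if r > 0 then w (r - 1) * Q ^ (m + r + 1) else w 0 * Q ^ Suc m)) * pair_inv m r)"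
  proof -
    have "(w (Suc r) * Q ^ (m - r) + w r * (1 + Q ^ (2 * m + 2)) +
        (if r > 0 then w (r - 1) * Q ^ (m + r + 1) else w 0 * Q ^ Suc m)) * pair_inv m r =
      w (Suc r) * Q ^ (m - r) * pair_inv m r + w r * (1 + Q ^ (2 * m + 2)) * pair_inv m r +
        (if r > 0 then w (r - 1) * Q ^ (m + r + 1) else 0) * pair_inv m r +
        (if r = 0 then w 0 * Q ^ Suc m * pair_inv m 0 else 0)" for r
      by (auto simp only: distrib_right split: if_splits) simp_all
    then show ?thesis by (simp only: sum.distrib) simp
  qed
  also have "\<dots> = (\<Sum>r\<le>m. (1 - Q ^ Suc m)\<^sup>2 * w r * pair_inv m r)"
    by (intro sum.cong refl) (simp only: coeff atMost_iff)
  also have "\<dots> = (1 - Q ^ Suc m)\<^sup>2 * J m"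
    by (simp add: J_def sum_distrib_left mult.assoc)
  also have "J m = qpoch m ^ 2 * qpoch_inv (2 * m + 1)"
    using Suc by (simp add: J_def w_def)
  also have "qpoch_inv (2 * m + 1) = (1 - Q ^ (2 * m + 2)) * ((1 - Q ^ (2 * m + 3)) * qpoch_inv (2 * m + 3))"
    using qpoch_inv_Suc[of "2 * m + 1"] qpoch_inv_Suc[of "2 * m + 2"] by (simp add: numeral_3_eq_3 numeral_2_eq_2)
  also have "(1 - Q ^ Suc m)\<^sup>2 * ((qpoch m)\<^sup>2 * ((1 - Q ^ (2 * m + 2)) * ((1 - Q ^ (2 * m + 3)) * qpoch_inv (2 * m + 3)))) =
      (1 - Q ^ (2 * m + 2)) * ((1 - Q ^ (2 * m + 3)) * ((qpoch (Suc m))\<^sup>2 * qpoch_inv (2 * m + 3)))"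
    unfolding qpoch_Suc by (simp only: power_mult_distrib mult_ac)
  finally have "(1 - Q ^ (2 * m + 3)) * J (Suc m) = (1 - Q ^ (2 * m + 3)) * ((qpoch (Suc m))\<^sup>2 * qpoch_inv (2 * m + 3))"
    by (rule unit_cancel[rotated]) simp
  then have "J (Suc m) = (qpoch (Suc m))\<^sup>2 * qpoch_inv (2 * m + 3)"
    by (rule unit_cancel[rotated]) simp
  then show ?case
    by (simp add: J_def w_def numeral_3_eq_3 del: sum.atMost_Suc)
qed

section \<open>Passage to the limit as congruences modulo Q^(N+1)\<close>

lemma qpoch_inv_limit:
  assumes "a \<le> b"
  shows "Q ^ Suc a dvd qpoch_inv a - qpoch_inv b"
  using assms
proof (induction b rule: dec_induct)
  case (step b)
  have "qpoch_inv b - qpoch_inv (Suc b) = - (Q ^ Suc b * qpoch_inv (Suc b))"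
    using qpoch_inv_Suc[of b] by (simp add: algebra_simps)
  then have "Q ^ Suc b dvd qpoch_inv b - qpoch_inv (Suc b)" by simp
  then have "Q ^ Suc a dvd qpoch_inv b - qpoch_inv (Suc b)"
    using step by (meson dvd_trans le_imp_power_dvd Suc_le_mono)
  with step.IH have "Q ^ Suc a dvd (qpoch_inv a - qpoch_inv b) + (qpoch_inv b - qpoch_inv (Suc b))" by (rule dvd_add)
  then show ?case by simp
qed simp

text \<open>Lowering the index from N to N - r loses r powers of Q in the congruence; the factor Q^e
  with e >= r repays them.\<close>

lemma qpoch_inv_shift_limit:
  assumes "r \<le> e" "r \<le> N"
  shows "Q ^ Suc N dvd Q ^ e * qpoch_inv (N - r) - Q ^ e * qpoch_inv N"
proof -
  have "Q ^ Suc N dvd Q ^ (e + Suc (N - r))"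
    using assms by (intro le_imp_power_dvd) simp
  also have "Q ^ (e + Suc (N - r)) dvd Q ^ e * (qpoch_inv (N - r) - qpoch_inv N)"
    unfolding power_add by (intro mult_dvd_mono dvd_refl qpoch_inv_limit) simp
  finally show ?thesis by (simp add: right_diff_distrib)
qed

lemma pair_inv_limit:
  assumes "r \<le> e" "r \<le> N"
  shows "Q ^ Suc N dvd Q ^ e * pair_inv N r - Q ^ e * (qpoch_inv N)\<^sup>2"
proof -
  have "Q ^ Suc N dvd (Q ^ e * qpoch_inv (N - r) - Q ^ e * qpoch_inv N) * qpoch_inv (N + r + 1)"
    using qpoch_inv_shift_limit[OF assms] by (rule dvd_mult2)
  moreover have "Q ^ Suc N dvd (qpoch_inv N - qpoch_inv (N + r + 1)) * (Q ^ e * qpoch_inv N)"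
    using qpoch_inv_limit[of N "N + r + 1"] by (intro dvd_mult2) simp
  ultimately have "Q ^ Suc N dvd (Q ^ e * qpoch_inv (N - r) - Q ^ e * qpoch_inv N) * qpoch_inv (N + r + 1) -
      (qpoch_inv N - qpoch_inv (N + r + 1)) * (Q ^ e * qpoch_inv N)"
    by (rule dvd_diff)
  also have "\<dots> = Q ^ e * pair_inv N r - Q ^ e * (qpoch_inv N)\<^sup>2"
    using assms by (simp add: pair_inv_def algebra_simps power2_eq_square)
  finally show ?thesis .
qed

lemma le_tri: "r \<le> r * (r + 1) div 2" for r :: nat
  by (induction r) (auto simp: algebra_simps)

text \<open>In \<open>bailey_finite\<close> every shifted inverse may be replaced by one at index N,
  since the exponents n (n + 1) and 3 r (r + 1) / 2 are at least n and r. The left side then carries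
  \<open>qpoch_inv N\<close> and the right side its square, so multiplication by the square of
  \<open>qpoch N\<close> leaves one Euler factor on the left.\<close>

lemma bailey_limit:
  assumes "\<And>r. (1 + Q ^ (2 * r + 1) - z * Q ^ r) * v r = 1"
  shows "Q ^ Suc N dvd qpoch N * (\<Sum>n\<le>N. Q ^ (n * (n + 1)) * (\<Prod>r\<le>n. v r)) -
    (\<Sum>r\<le>N. (-1) ^ r * Q ^ (3 * (r * (r + 1) div 2)) * (1 - Q ^ (2 * r + 1)) * v r)"
    (is "_ dvd qpoch N * ?G - ?A")
proof -
  have le3: "r \<le> 3 * (r * (r + 1) div 2)" for r :: nat
    using le_tri[of r] by linarith
  have "Q ^ Suc N dvd (\<Sum>n\<le>N. (Q ^ (n * (n + 1)) * qpoch_inv (N - n) - Q ^ (n * (n + 1)) * qpoch_inv N) * (\<Prod>r\<le>n. v r))"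
    by (intro dvd_sum dvd_mult2 qpoch_inv_shift_limit) auto
  then have G: "Q ^ Suc N dvd
      (\<Sum>n\<le>N. Q ^ (n * (n + 1)) * qpoch_inv (N - n) * (\<Prod>r\<le>n. v r)) - qpoch_inv N * ?G"
    by (simp only: left_diff_distrib right_diff_distrib sum_subtractf sum_distrib_left mult_ac)
  define c where "c r = (-1) ^ r * (1 - Q ^ (2 * r + 1)) * v r" for r
  define e where "e r = Q ^ (3 * (r * (r + 1) div 2))" for r
  have c: "(-1) ^ r * e r * (1 - Q ^ (2 * r + 1)) * v r = c r * e r" for r
    by (simp only: c_def mult_ac)
  have "Q ^ Suc N dvd (\<Sum>r\<le>N. c r * (e r * pair_inv N r - e r * (qpoch_inv N)\<^sup>2))"
    unfolding e_def by (intro dvd_sum dvd_mult pair_inv_limit le3) simp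
  then have A: "Q ^ Suc N dvd (\<Sum>r\<le>N. c r * e r * pair_inv N r) - (qpoch_inv N)\<^sup>2 * (\<Sum>r\<le>N. c r * e r)"
    by (simp only: right_diff_distrib sum_subtractf sum_distrib_left mult_ac)
  from dvd_diff[OF A G] have "Q ^ Suc N dvd qpoch_inv N * ?G - (qpoch_inv N)\<^sup>2 * ?A"
    unfolding bailey_finite[OF assms] e_def[symmetric] c by (simp add: algebra_simps)
  then have "Q ^ Suc N dvd (qpoch N)\<^sup>2 * (qpoch_inv N * ?G - (qpoch_inv N)\<^sup>2 * ?A)"
    by (rule dvd_mult)
  also have "\<dots> = qpoch N * (qpoch N * qpoch_inv N) * ?G - (qpoch N * qpoch_inv N)\<^sup>2 * ?A"
    by (simp add: algebra_simps power2_eq_square)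
  finally show ?thesis by (simp add: qpoch_mult_inv)
qed

text \<open>The kernel tends to the square of \<open>qpoch_inv N\<close> and
  \<open>qpoch_inv (2 * N + 1)\<close> to \<open>qpoch_inv N\<close>; clearing the denominators
  turns the square on the right of the finite form into a cube.\<close>

lemma jacobi_cube_limit:
  "Q ^ Suc N dvd qpoch N ^ 3 - (\<Sum>r\<le>N. (-1) ^ r * of_nat (2 * r + 1) * Q ^ (r * (r + 1) div 2))"
    (is "_ dvd _ - ?J")
proof -
  have "Q ^ Suc N dvd (\<Sum>r\<le>N. ((-1) ^ r * of_nat (2 * r + 1)) *
      (Q ^ (r * (r + 1) div 2) * pair_inv N r - Q ^ (r * (r + 1) div 2) * (qpoch_inv N)\<^sup>2))"
    by (intro dvd_sum dvd_mult pair_inv_limit le_tri) simp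
  then have "Q ^ Suc N dvd
      (\<Sum>r\<le>N. (-1) ^ r * of_nat (2 * r + 1) * Q ^ (r * (r + 1) div 2) * pair_inv N r) - (qpoch_inv N)\<^sup>2 * ?J"
    by (simp only: right_diff_distrib sum_subtractf sum_distrib_left mult_ac)
  then have "Q ^ Suc N dvd (qpoch N)\<^sup>2 * qpoch_inv (2 * N + 1) - (qpoch_inv N)\<^sup>2 * ?J"
    unfolding jacobi_cube_finite .
  moreover have "Q ^ Suc N dvd (qpoch N)\<^sup>2 * (qpoch_inv N - qpoch_inv (2 * N + 1))"
    by (intro dvd_mult qpoch_inv_limit) simp
  ultimately have "Q ^ Suc N dvd ((qpoch N)\<^sup>2 * qpoch_inv (2 * N + 1) - (qpoch_inv N)\<^sup>2 * ?J) + (qpoch N)\<^sup>2 * (qpoch_inv N - qpoch_inv (2 * N + 1))"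
    by (rule dvd_add)
  then have "Q ^ Suc N dvd (qpoch N)\<^sup>2 * qpoch_inv N - (qpoch_inv N)\<^sup>2 * ?J"
    by (simp add: algebra_simps)
  then have "Q ^ Suc N dvd (qpoch N)\<^sup>2 * ((qpoch N)\<^sup>2 * qpoch_inv N - (qpoch_inv N)\<^sup>2 * ?J)"
    by (rule dvd_mult)
  also have "\<dots> = (qpoch N) ^ 3 * (qpoch N * qpoch_inv N) - (qpoch N * qpoch_inv N)\<^sup>2 * ?J"
    by (simp add: algebra_simps power2_eq_square power3_eq_cube)
  finally show ?thesis by (simp add: qpoch_mult_inv)
qed

end

section \<open>Parity of representation numbers\<close>

lemma even_card_fixpoint_free:
  assumes "finite A" "\<And>x. x \<in> A \<Longrightarrow> f x \<in> A \<and> f (f x) = x \<and> f x \<noteq> x"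
  shows "even (card A)"
  using assms
proof (induction A rule: finite_psubset_induct)
  case (psubset A)
  show ?case
  proof (cases "A = {}")
    case False
    then obtain x where x: "x \<in> A" by blast
    let ?B = "A - {x, f x}"
    have "even (card ?B)"
    proof (rule psubset.IH)
      show "?B \<subset> A" using x by blast
      show "f y \<in> ?B \<and> f (f y) = y \<and> f y \<noteq> y" if "y \<in> ?B" for y
        using psubset.prems that x by (metis DiffD1 DiffD2 DiffI insert_iff empty_iff)
    qed
    moreover have "card A = card ?B + 2"
    proof -
      have fx: "f x \<in> A" "x \<noteq> f x" using psubset.prems[OF x] by metis+
      then have "card {x, f x} = 2" by simp
      moreover have "card ?B = card A - card {x, f x}"
        using fx x by (intro card_Diff_subset) auto
      moreover have "card {x, f x} \<le> card A"
        using fx x psubset.hyps by (intro card_mono) auto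
      ultimately show ?thesis by linarith
    qed
    ultimately show ?thesis by simp
  qed simp
qed

lemma card_split:
  assumes "finite A"
  shows "card A = card {x \<in> A. Pr x} + card {x \<in> A. \<not> Pr x}"
proof -
  have "A = {x \<in> A. Pr x} \<union> {x \<in> A. \<not> Pr x}" by blast
  also have "card \<dots> = card {x \<in> A. Pr x} + card {x \<in> A. \<not> Pr x}"
    using assms by (intro card_Un_disjoint) auto
  finally show ?thesis .
qed

lemma even_card_involution:
  assumes "finite A" "\<And>x. x \<in> A \<Longrightarrow> f x \<in> A \<and> f (f x) = x"
  shows "even (card A) \<longleftrightarrow> even (card {x \<in> A. f x = x})"
proof -
  have "even (card {x \<in> A. f x \<noteq> x})"
    by (rule even_card_fixpoint_free[where f = f]) (use assms in auto)
  moreover have "card A = card {x \<in> A. f x = x} + card {x \<in> A. f x \<noteq> x}"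
    using assms(1) by (rule card_split)
  ultimately show ?thesis by simp
qed

lemma bij_betw_card_witness:
  assumes "\<And>x. x \<in> A \<Longrightarrow> f x \<in> B \<and> g (f x) = x" "\<And>y. y \<in> B \<Longrightarrow> g y \<in> A \<and> f (g y) = y"
  shows "card A = card B"
  by (rule bij_betw_same_card[of f], rule bij_betw_byWitness[where f' = g]) (use assms in auto)

lemma finite_int_triples:
  assumes "\<And>x y z. (x, y, z) \<in> A \<Longrightarrow> \<bar>x\<bar> \<le> N \<and> \<bar>y\<bar> \<le> N \<and> \<bar>z\<bar> \<le> (N::int)"
  shows "finite A"
proof (rule finite_subset)
  show "A \<subseteq> {-N..N} \<times> {-N..N} \<times> {-N..N}"
  proof
    fix t assume t: "t \<in> A"
    obtain x y z where "t = (x, y, z)" by (cases t)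
    with assms[of x y z] t show "t \<in> {-N..N} \<times> {-N..N} \<times> {-N..N}" by auto
  qed
qed simp

lemma finite_int_pairs:
  assumes "\<And>x y. (x, y) \<in> A \<Longrightarrow> \<bar>x\<bar> \<le> N \<and> \<bar>y\<bar> \<le> (N::int)"
  shows "finite A"
proof (rule finite_subset)
  show "A \<subseteq> {-N..N} \<times> {-N..N}"
  proof
    fix t assume t: "t \<in> A"
    obtain x y where "t = (x, y)" by (cases t)
    with assms[of x y] t show "t \<in> {-N..N} \<times> {-N..N}" by auto
  qed
qed simp

lemma abs_le_square: "\<bar>x\<bar> \<le> x * x" for x :: int
proof (cases "x = 0")
  case False
  then have "\<bar>x\<bar> * 1 \<le> \<bar>x\<bar> * \<bar>x\<bar>" by (intro mult_left_mono) simp_all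
  then show ?thesis by simp
qed simp

lemma le_mult_pos: "x \<le> x * y" "y \<le> x * y" if "x > 0" "y > 0" for x y :: int
  using that by (auto simp: mult_le_cancel_left1 mult_le_cancel_right1)

lemma square_mod_4: "x * x mod 4 = (if even x then 0 else 1)" for x :: int
proof (cases "even x")
  case True
  then obtain b where "x = 2 * b" by (rule evenE)
  then have "x * x = 4 * (b * b)" by simp
  then show ?thesis using True by simp
next
  case False
  then obtain b where "x = 2 * b + 1" by (rule oddE)
  then have "x * x = 1 + 4 * (b * b + b)" by (simp add: algebra_simps)
  then have "x * x mod 4 = 1" by (simp only: mod_mult_self2) simp
  then show ?thesis using False by simp
qed

lemma odd_square_mod_8: "x * x mod 8 = 1" if "odd x" for x :: int
proof -
  from that obtain b where b: "x = 2 * b + 1" by (rule oddE)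
  have "even (b * (b + 1))" by simp
  then obtain c where "b * (b + 1) = 2 * c" by (rule evenE)
  then have "x * x = 1 + 8 * c" unfolding b by (simp add: algebra_simps)
  then show ?thesis by (simp only: mod_mult_self2) simp
qed

lemma square_inj_pos: "x * x = y * y \<Longrightarrow> x > 0 \<Longrightarrow> y > 0 \<Longrightarrow> x = y" for x y :: int
  by (simp add: square_eq_iff)

section \<open>Factor pairs, sums of two squares and Zagier's involution\<close>

definition root_3_mod_4 :: "int \<Rightarrow> bool" where
  "root_3_mod_4 S \<longleftrightarrow> (\<exists>w>0. w * w = S \<and> w mod 4 = 3)"

lemma root_3_mod_4_iff: "w > 0 \<Longrightarrow> root_3_mod_4 (w * w) \<longleftrightarrow> w mod 4 = 3"
  unfolding root_3_mod_4_def using square_inj_pos by blast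

definition factor_pairs :: "int \<Rightarrow> (int \<times> int) set" where
  "factor_pairs S = {(p, n). p * n = S \<and> 0 < p \<and> p < n}"

definition two_squares :: "int \<Rightarrow> (int \<times> int) set" where
  "two_squares S = {(p, h). p * p + h * h = S \<and> 0 < p \<and> 0 < h \<and> even h}"

lemma finite_factor_pairs: "finite (factor_pairs S)"
  unfolding factor_pairs_def
  by (rule finite_int_pairs[of _ "\<bar>S\<bar>"]) (auto simp: abs_mult le_mult_pos)

lemma finite_two_squares: "finite (two_squares S)"
  unfolding two_squares_def
proof (rule finite_int_pairs[of _ S])
  show "\<bar>p\<bar> \<le> S \<and> \<bar>h\<bar> \<le> S" if "(p, h) \<in> {(p, h). p * p + h * h = S \<and> 0 < p \<and> 0 < h \<and> even h}" for p h
  proof -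
    have "p * p + h * h = S" using that by simp
    then show ?thesis using abs_le_square[of p] abs_le_square[of h] by linarith
  qed
qed

definition zagier :: "int \<times> int \<times> int \<Rightarrow> int \<times> int \<times> int" where
  "zagier = (\<lambda>(x, y, z).
    if x < y - z then (x + 2 * z, z, y - x - z)
    else if x < 2 * y then (2 * y - x, y, x - y + z)
    else (x - 2 * y, x - y + z, y))"

lemma mult_mod_4_eq_1:
  fixes a b :: int
  assumes "a * b mod 4 = 1"
  shows "a mod 4 = b mod 4"
proof -
  have "u = v" if "u \<in> {0, 1, 2, 3}" "v \<in> {0, 1, 2, 3}" "u * v mod 4 = 1" for u v :: int
    using that by auto
  then show ?thesis by this (auto simp: assms mod_mult_eq)
qed

text \<open>Zagier's map is undefined on the line \<open>x = y - z\<close>, which carries solutions only if \<open>S\<close> is a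
  square; those \<open>(w - 1) / 2\<close> solutions cause the correction term.\<close>

lemma even_card_factor_pairs:
  assumes S: "S > 0" "S mod 4 = 1"
  shows "even (card (factor_pairs S)) \<longleftrightarrow>
    even (card (two_squares S) + (if root_3_mod_4 S then 1 else 0))"
proof -
  define Z where "Z = {(x, y, z). x * x + 4 * (y * z) = S \<and> x > 0 \<and> y > 0 \<and> z > 0}"
  define B where "B = {(x, y, z) \<in> Z. x = y - z}"
  have finZ: "finite Z"
  proof (rule finite_int_triples[of _ S])
    fix x y z assume "(x, y, z) \<in> Z"
    then have *: "x * x + 4 * (y * z) = S" "x > 0" "y > 0" "z > 0" by (auto simp: Z_def)
    then have "y \<le> y * z" "z \<le> y * z" by (auto intro: le_mult_pos)
    then show "\<bar>x\<bar> \<le> S \<and> \<bar>y\<bar> \<le> S \<and> \<bar>z\<bar> \<le> S"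
      using abs_le_square[of x] * by linarith
  qed
  have odd_x: "odd x" if "(x, y, z) \<in> Z" for x y z
  proof -
    have "x * x mod 4 = (x * x + 4 * (y * z)) mod 4" by simp
    also have "x * x + 4 * (y * z) = S" using that by (simp add: Z_def)
    finally show ?thesis using S(2) square_mod_4[of x] by (cases "even x") simp_all
  qed
  \<comment> \<open>The exchange of y and z fixes the solutions with y = z, that is S = x^2 + (2
    y)^2.\<close>
  have "even (card Z) \<longleftrightarrow> even (card {t \<in> Z. (\<lambda>(x, y, z). (x, z, y)) t = t})"
    by (rule even_card_involution[OF finZ]) (auto simp: Z_def mult.commute)
  also have "card {t \<in> Z. (\<lambda>(x, y, z). (x, z, y)) t = t} = card (two_squares S)"
    by (rule bij_betw_card_witness[where f = "\<lambda>(x, y, z). (x, 2 * y)" and g = "\<lambda>(p, h). (p, h div 2, h div 2)"])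
      (auto simp: Z_def two_squares_def elim!: evenE)
  finally have 1: "even (card Z) \<longleftrightarrow> even (card (two_squares S))" .
  have "even (card (Z - B)) \<longleftrightarrow> even (card {t \<in> Z - B. zagier t = t})"
  proof (rule even_card_involution)
    fix t assume t: "t \<in> Z - B"
    obtain x y z where xyz: "t = (x, y, z)" by (cases t)
    have pos: "x * x + 4 * (y * z) = S" "x > 0" "y > 0" "z > 0" "x \<noteq> y - z"
      using t by (auto simp: Z_def B_def xyz)
    have "odd x" using t odd_x by (auto simp: xyz)
    then have "x \<noteq> 2 * y" by auto
    then consider "x < y - z" | "y - z < x" "x < 2 * y" | "2 * y < x" using pos by linarith
    then show "zagier t \<in> Z - B \<and> zagier (zagier t) = t"
    proof cases
      case 1
      then have "zagier t = (x + 2 * z, z, y - x - z)" by (simp add: xyz zagier_def)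
      moreover have "zagier (x + 2 * z, z, y - x - z) = t" using 1 pos by (simp add: zagier_def xyz)
      moreover have "(x + 2 * z) * (x + 2 * z) + 4 * ((z) * (y - x - z)) = x * x + 4 * (y * z)"
        by (simp add: algebra_simps)
      ultimately show ?thesis using 1 pos by (simp add: Z_def B_def)
    next
      case 2
      then have "zagier t = (2 * y - x, y, x - y + z)" by (simp add: xyz zagier_def)
      moreover have "zagier (2 * y - x, y, x - y + z) = t" using 2 pos by (simp add: zagier_def xyz)
      moreover have "(2 * y - x) * (2 * y - x) + 4 * ((y) * (x - y + z)) = x * x + 4 * (y * z)"
        by (simp add: algebra_simps)
      ultimately show ?thesis using 2 pos by (simp add: Z_def B_def)
    next
      case 3
      then have "zagier t = (x - 2 * y, x - y + z, y)" using pos by (simp add: xyz zagier_def)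
      moreover have "zagier (x - 2 * y, x - y + z, y) = t" using 3 pos by (simp add: zagier_def xyz)
      moreover have "(x - 2 * y) * (x - 2 * y) + 4 * ((x - y + z) * (y)) = x * x + 4 * (y * z)"
        by (simp add: algebra_simps)
      ultimately show ?thesis using 3 pos by (simp add: Z_def B_def)
    qed
  qed (use finZ in simp)
  \<comment> \<open>Only the middle branch has fixed points, those with y = x, and there the
    equation reads x (x + 4 z) = S. Conversely the factors of a pair agree mod 4 because S is 1 mod
    4, so z is an integer.\<close>
  also have "card {t \<in> Z - B. zagier t = t} = card (factor_pairs S)"
  proof (rule bij_betw_card_witness[where f = "\<lambda>(x, y, z). (x, x + 4 * z)" and g = "\<lambda>(p, n). (p, p, (n - p) div 4)"])
    fix t assume t: "t \<in> {t \<in> Z - B. zagier t = t}"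
    obtain x y z where xyz: "t = (x, y, z)" by (cases t)
    have pos: "x * x + 4 * (y * z) = S" "x > 0" "y > 0" "z > 0" and e: "zagier (x, y, z) = (x, y, z)"
    proof -
      have "t \<in> Z" "zagier t = t" using t by blast+
      then show "x * x + 4 * (y * z) = S" "x > 0" "y > 0" "z > 0" "zagier (x, y, z) = (x, y, z)"
        unfolding xyz Z_def by blast+
    qed
    have y: "y = x"
    proof -
      consider "x < y - z" | "\<not> x < y - z" "x < 2 * y" | "\<not> x < y - z" "\<not> x < 2 * y" by blast
      then show ?thesis
      proof cases
        case 1
        then have "zagier (x, y, z) = (x + 2 * z, z, y - x - z)" unfolding zagier_def by simp
        then have "x + 2 * z = x" using arg_cong[OF e, of fst] by (simp only: fst_conv)
        then show ?thesis using pos by simp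
      next
        case 2
        then have "zagier (x, y, z) = (2 * y - x, y, x - y + z)" unfolding zagier_def by simp
        then have "2 * y - x = x" using arg_cong[OF e, of fst] by (simp only: fst_conv)
        then show ?thesis by simp
      next
        case 3
        then have "zagier (x, y, z) = (x - 2 * y, x - y + z, y)" unfolding zagier_def by simp
        then have "x - 2 * y = x" using arg_cong[OF e, of fst] by (simp only: fst_conv)
        then show ?thesis using pos by simp
      qed
    qed
    have "x * (x + 4 * z) = S" using pos(1) unfolding y by (simp add: algebra_simps)
    then show "(\<lambda>(x, y, z). (x, x + 4 * z)) t \<in> factor_pairs S \<and>
        (\<lambda>(p, n). (p, p, (n - p) div 4)) ((\<lambda>(x, y, z). (x, x + 4 * z)) t) = t"
      using pos unfolding xyz y factor_pairs_def by simp
  next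
    fix t assume t: "t \<in> factor_pairs S"
    obtain p n where pn: "t = (p, n)" by (cases t)
    have "p mod 4 = n mod 4" using t S by (intro mult_mod_4_eq_1) (auto simp: pn factor_pairs_def)
    then have "4 dvd n - p" using mod_eq_dvd_iff[of n 4 p] by simp
    then obtain k where "n - p = 4 * k" by (rule dvdE)
    then have n: "n = p + 4 * k" by simp
    have t': "p * n = S" "0 < p" "p < n" using t by (simp_all add: pn factor_pairs_def)
    have "p * p + 4 * (p * k) = p * n" unfolding n by (simp add: algebra_simps)
    then have "p > 0" "k > 0" "p * p + 4 * (p * k) = S" using t' n by simp_all
    then show "(\<lambda>(p, n). (p, p, (n - p) div 4)) t \<in> {t \<in> Z - B. zagier t = t} \<and>
        (\<lambda>(x, y, z). (x, x + 4 * z)) ((\<lambda>(p, n). (p, p, (n - p) div 4)) t) = t"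
      by (simp add: pn n Z_def B_def zagier_def)
  qed
  finally have 2: "even (card (Z - B)) \<longleftrightarrow> even (card (factor_pairs S))" .
  \<comment> \<open>On B the equation becomes (y + z)^2 = S. If S = w^2 with w = 2 k + 1, then x = w
    - 2 z > 0 leaves z = 1, ..., k, and k is odd exactly when w = 3 mod 4.\<close>
  have 3: "even (card B) \<longleftrightarrow> \<not> root_3_mod_4 S"
  proof (cases "\<exists>w>0. w * w = S")
    case True
    then obtain w where w: "w > 0" "w * w = S" by blast
    then have "odd w" using S square_mod_4[of w] by (auto split: if_splits)
    then obtain k where k: "w = 2 * k + 1" by (auto elim: oddE)
    have k0: "k \<ge> 0" using w k by simp
    have "card B = card {1..k}"
    proof (rule bij_betw_card_witness[where f = "\<lambda>(x, y, z). z" and g = "\<lambda>z. (w - 2 * z, w - z, z)"])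
      fix t assume t: "t \<in> B"
      obtain x y z where xyz: "t = (x, y, z)" by (cases t)
      have *: "x = y - z" "x > 0" "y > 0" "z > 0" "x * x + 4 * (y * z) = S" using t by (auto simp: B_def Z_def xyz)
      have "(y + z) * (y + z) = (y - z) * (y - z) + 4 * (y * z)" by (simp add: algebra_simps)
      also have "\<dots> = w * w" using *(5) unfolding *(1) w(2) .
      finally have "(y + z) * (y + z) = w * w" .
      then have "y + z = w" by (rule square_inj_pos) (use * w in simp_all)
      then show "(\<lambda>(x, y, z). z) t \<in> {1..k} \<and> (\<lambda>z. (w - 2 * z, w - z, z)) ((\<lambda>(x, y, z). z) t) = t"
        using * k by (auto simp: xyz)
    next
      fix z assume z: "z \<in> {1..k}"
      have "(w - 2 * z) * (w - 2 * z) + 4 * ((w - z) * z) = w * w" by (simp add: algebra_simps)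
      then show "(w - 2 * z, w - z, z) \<in> B \<and> (\<lambda>(x, y, z). z) (w - 2 * z, w - z, z) = z"
        using z k w(2) unfolding B_def Z_def by simp
    qed
    then have "card B = nat k" by simp
    moreover have "w mod 4 = 3 \<longleftrightarrow> odd k" unfolding k by presburger
    ultimately show ?thesis using root_3_mod_4_iff[OF w(1)] w(2) k0 by (simp add: even_nat_iff)
  next
    case False
    have "B = {}"
    proof (rule equals0I)
      fix t assume t: "t \<in> B"
      obtain x y z where xyz: "t = (x, y, z)" by (cases t)
      have *: "x = y - z" "y > 0" "z > 0" "x * x + 4 * (y * z) = S" using t by (auto simp: B_def Z_def xyz)
      have "(y + z) * (y + z) = (y - z) * (y - z) + 4 * (y * z)" by (simp add: algebra_simps)
      also have "\<dots> = S" using *(4) unfolding *(1) .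
      finally have "(y + z) * (y + z) = S" .
      moreover have "y + z > 0" using * by simp
      ultimately show False using False by blast
    qed
    moreover have "\<not> root_3_mod_4 S" using False unfolding root_3_mod_4_def by blast
    ultimately show ?thesis by simp
  qed
  have "B \<subseteq> Z" by (auto simp: B_def)
  then have "card (Z - B) = card Z - card B" "card B \<le> card Z"
    using finZ by (auto intro: card_Diff_subset card_mono finite_subset)
  then have "even (card Z) \<longleftrightarrow> (even (card (Z - B)) \<longleftrightarrow> even (card B))"
    by auto
  with 1 2 3 show ?thesis by (cases "root_3_mod_4 S") auto
qed

section \<open>Triples of indefinite forms and short representations by x^2 + 3 y^2\<close>

definition swap_triples :: "int \<Rightarrow> (int \<times> int \<times> int) set" where
  "swap_triples S = {(p, n, f). p * n + f * f = S \<and> p > 0 \<and> n > 0 \<and> odd p \<and> odd n \<and> even f \<and> f + p < n}"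

lemma odd_factors:
  fixes p n f S :: int
  assumes "p * n + f * f = S" "odd S" "even f"
  shows "odd p \<and> odd n"
  using assms by auto

lemma finite_swap_triples: "finite (swap_triples S)"
proof (rule finite_int_triples[of _ S])
  fix p n f assume "(p, n, f) \<in> swap_triples S"
  then have *: "p * n + f * f = S" "p > 0" "n > 0" by (auto simp: swap_triples_def)
  then have "p \<le> p * n" "n \<le> p * n" by (auto intro: le_mult_pos)
  then show "\<bar>p\<bar> \<le> S \<and> \<bar>n\<bar> \<le> S \<and> \<bar>f\<bar> \<le> S"
    using abs_le_square[of f] * by linarith
qed

definition short_reps :: "int \<Rightarrow> (int \<times> int) set" where
  "short_reps S = {(x, y). x * x + 3 * (y * y) = S \<and> x > y \<and> y > 0}"

text \<open>Where \<open>\<bar>f\<bar> < n - p\<close> flip the sign of \<open>f\<close>, where \<open>\<bar>n - p\<bar> < - f\<close> swap \<open>p\<close> and \<open>n\<close>; elsewhere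
  \<open>f = p - n\<close>, and then \<open>p n + f\<^sup>2 = x\<^sup>2 + 3 y\<^sup>2\<close> with \<open>p = x - y\<close>, \<open>n = x + y\<close>.\<close>

lemma even_card_swap_triples:
  assumes S: "S > 0" "S mod 4 = 1"
  shows "even (card (swap_triples S)) \<longleftrightarrow> even (card (short_reps S) + (if root_3_mod_4 S then 1 else 0))"
proof -
  have "odd S" using S(2) by presburger
  define \<phi> where "\<phi> = (\<lambda>(p, n, f). if \<bar>f\<bar> < n - p then (p, n, - f)
    else if \<bar>n - p\<bar> < - f then (n, p, f) else (p, n, f :: int))"
  define F where "F = {t \<in> swap_triples S. \<phi> t = t}"
  have "even (card (swap_triples S)) \<longleftrightarrow> even (card F)"
    unfolding F_def
  proof (rule even_card_involution[OF finite_swap_triples])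
    fix t assume t: "t \<in> swap_triples S"
    obtain p n f where pnf: "t = (p, n, f)" by (cases t)
    have *: "p * n + f * f = S" "p > 0" "n > 0" "odd p" "odd n" "even f" "f + p < n"
      using t by (simp_all add: swap_triples_def pnf)
    consider "\<bar>f\<bar> < n - p" | "\<not> \<bar>f\<bar> < n - p" "\<bar>n - p\<bar> < - f" | "\<not> \<bar>f\<bar> < n - p" "\<not> \<bar>n - p\<bar> < - f"
      by blast
    then show "\<phi> t \<in> swap_triples S \<and> \<phi> (\<phi> t) = t"
    proof cases
      case 1
      then show ?thesis using * by (simp add: pnf \<phi>_def swap_triples_def)
    next
      case 2
      then have "f + n < p" "\<not> \<bar>f\<bar> < p - n" "\<bar>p - n\<bar> < - f" by linarith+
      then show ?thesis using 2 * by (simp add: pnf \<phi>_def swap_triples_def mult.commute)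
    next
      case 3
      then show ?thesis using t by (simp add: pnf \<phi>_def)
    qed
  qed
  \<comment> \<open>The fixed points are of three types: f = 0 gives factor pairs, p = n with f < 0
    gives two squares, and the line f = p - n < 0 gives short representations.\<close>
  also have "card F = card {t \<in> F. snd (snd t) = 0} + card {t \<in> F. \<not> snd (snd t) = 0}"
    by (rule card_split) (simp add: F_def finite_swap_triples)
  also have "card {t \<in> F. \<not> snd (snd t) = 0} =
      card {t \<in> {t \<in> F. \<not> snd (snd t) = 0}. fst t = fst (snd t)} +
      card {t \<in> {t \<in> F. \<not> snd (snd t) = 0}. \<not> fst t = fst (snd t)}"
    by (rule card_split) (simp add: F_def finite_swap_triples)
  also have "card {t \<in> F. snd (snd t) = 0} = card (factor_pairs S)"
  proof (rule bij_betw_card_witness[where f = "\<lambda>(p, n, f). (p, n)" and g = "\<lambda>(p, n). (p, n, 0)"])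
    fix t assume t: "t \<in> {t \<in> F. snd (snd t) = 0}"
    obtain p n f where pnf: "t = (p, n, f)" by (cases t)
    have "f = 0" using t by (simp add: pnf)
    moreover have "(p, n, f) \<in> swap_triples S" using t unfolding pnf F_def by blast
    ultimately show "(\<lambda>(p, n, f). (p, n)) t \<in> factor_pairs S \<and> (\<lambda>(p, n). (p, n, 0)) ((\<lambda>(p, n, f). (p, n)) t) = t"
      by (simp add: pnf swap_triples_def factor_pairs_def)
  next
    fix t assume t: "t \<in> factor_pairs S"
    obtain p n where pn: "t = (p, n)" by (cases t)
    have *: "p * n = S" "0 < p" "p < n" using t by (simp_all add: pn factor_pairs_def)
    have "odd p \<and> odd n" by (rule odd_factors[of p n 0 S]) (use * \<open>odd S\<close> in simp_all)
    then show "(\<lambda>(p, n). (p, n, 0)) t \<in> {t \<in> F. snd (snd t) = 0} \<and> (\<lambda>(p, n, f). (p, n)) ((\<lambda>(p, n). (p, n, 0)) t) = t"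
      using * by (simp add: pn F_def swap_triples_def \<phi>_def)
  qed
  also have "card {t \<in> {t \<in> F. \<not> snd (snd t) = 0}. fst t = fst (snd t)} = card (two_squares S)"
  proof (rule bij_betw_card_witness[where f = "\<lambda>(p, n, f). (p, - f)" and g = "\<lambda>(p, h). (p, p, - h)"])
    fix t assume t: "t \<in> {t \<in> {t \<in> F. \<not> snd (snd t) = 0}. fst t = fst (snd t)}"
    obtain p n f where pnf: "t = (p, n, f)" by (cases t)
    have "n = p" using t by (simp add: pnf)
    moreover have "(p, n, f) \<in> swap_triples S" using t unfolding pnf F_def by blast
    ultimately show "(\<lambda>(p, n, f). (p, - f)) t \<in> two_squares S \<and>
        (\<lambda>(p, h). (p, p, - h)) ((\<lambda>(p, n, f). (p, - f)) t) = t"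
      by (simp add: pnf swap_triples_def two_squares_def)
  next
    fix t assume t: "t \<in> two_squares S"
    obtain p h where pn: "t = (p, h)" by (cases t)
    have *: "p * p + h * h = S" "0 < p" "0 < h" "even h" using t by (simp_all add: pn two_squares_def)
    have "odd p \<and> odd p" by (rule odd_factors[of p p h S]) (use * \<open>odd S\<close> in simp_all)
    then show "(\<lambda>(p, h). (p, p, - h)) t \<in> {t \<in> {t \<in> F. \<not> snd (snd t) = 0}. fst t = fst (snd t)} \<and>
        (\<lambda>(p, n, f). (p, - f)) ((\<lambda>(p, h). (p, p, - h)) t) = t"
      using * by (simp add: pn F_def swap_triples_def \<phi>_def)
  qed
  also have "card {t \<in> {t \<in> F. \<not> snd (snd t) = 0}. \<not> fst t = fst (snd t)} = card (short_reps S)"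
  proof (rule bij_betw_card_witness[where f = "\<lambda>(p, n, f). (p - f div 2, - (f div 2))" and g = "\<lambda>(x, y). (x - y, x + y, - 2 * y)"])
    fix t assume t: "t \<in> {t \<in> {t \<in> F. \<not> snd (snd t) = 0}. \<not> fst t = fst (snd t)}"
    obtain p n f where pnf: "t = (p, n, f)" by (cases t)
    have *: "n \<noteq> p" "f \<noteq> 0" "\<phi> (p, n, f) = (p, n, f)" using t by (simp_all add: pnf F_def)
    have u: "p * n + f * f = S" "p > 0" "n > 0" "odd p" "odd n" "even f" "f + p < n"
      using t by (simp_all add: swap_triples_def pnf F_def)
    have 1: "\<not> \<bar>f\<bar> < n - p"
    proof
      assume "\<bar>f\<bar> < n - p"
      then have "\<phi> (p, n, f) = (p, n, - f)" by (simp add: \<phi>_def)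
      then show False using * by simp
    qed
    have 2: "\<not> \<bar>n - p\<bar> < - f"
    proof
      assume "\<bar>n - p\<bar> < - f"
      with 1 have "\<phi> (p, n, f) = (n, p, f)" by (simp add: \<phi>_def)
      then show False using * by simp
    qed
    obtain y where y: "f = 2 * y" using u by (auto elim: evenE)
    have n: "n = p - 2 * y" and "y < 0" using 1 2 u *(1,2) y by linarith+
    have "(p - y) * (p - y) + 3 * (y * y) = p * n + f * f" unfolding n y by (simp add: algebra_simps)
    then show "(\<lambda>(p, n, f). (p - f div 2, - (f div 2))) t \<in> short_reps S \<and>
        (\<lambda>(x, y). (x - y, x + y, - 2 * y)) ((\<lambda>(p, n, f). (p - f div 2, - (f div 2))) t) = t"
      using u(1,2) \<open>y < 0\<close> by (simp add: pnf y n short_reps_def)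
  next
    fix t assume t: "t \<in> short_reps S"
    obtain x y where xy: "t = (x, y)" by (cases t)
    have *: "x * x + 3 * (y * y) = S" "x > y" "y > 0" using t by (simp_all add: xy short_reps_def)
    have e: "(x - y) * (x + y) + (- 2 * y) * (- 2 * y) = S" using *(1) by (simp add: algebra_simps)
    have "odd (x - y) \<and> odd (x + y)" by (rule odd_factors[OF e \<open>odd S\<close>]) simp
    then have "(x - y, x + y, - 2 * y) \<in> swap_triples S" using e * by (simp add: swap_triples_def)
    moreover have "\<phi> (x - y, x + y, - 2 * y) = (x - y, x + y, - 2 * y)" using * by (simp add: \<phi>_def)
    moreover have "- (2 * y) div 2 = - y" by presburger
    ultimately show "(\<lambda>(x, y). (x - y, x + y, - 2 * y)) t \<in> {t \<in> {t \<in> F. \<not> snd (snd t) = 0}. \<not> fst t = fst (snd t)} \<and>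
        (\<lambda>(p, n, f). (p - f div 2, - (f div 2))) ((\<lambda>(x, y). (x - y, x + y, - 2 * y)) t) = t"
      using *(2,3) by (simp add: xy F_def)
  qed
  \<comment> \<open>By \<open>even_card_factor_pairs\<close> the first two types cancel modulo 2 up
    to the root term.\<close>
  finally show ?thesis
    using even_card_factor_pairs[OF S] by (cases "root_3_mod_4 S") auto
qed

definition skew_triples :: "int \<Rightarrow> (int \<times> int \<times> int) set" where
  "skew_triples S = {(a, d, e). e * e + a * d = S \<and> odd a \<and> a > 0 \<and> 2 * e > - a \<and> d > a + e}"

lemma finite_skew_triples: "finite (skew_triples S)"
proof (rule finite_int_triples[of _ S])
  fix a d e assume "(a, d, e) \<in> skew_triples S"
  then have *: "e * e + a * d = S" "a > 0" "2 * e > - a" "d > a + e" by (auto simp: skew_triples_def)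
  then have "d > 0" by linarith
  then have "a \<le> a * d" "d \<le> a * d" using * by (auto intro: le_mult_pos)
  then show "\<bar>a\<bar> \<le> S \<and> \<bar>d\<bar> \<le> S \<and> \<bar>e\<bar> \<le> S"
    using abs_le_square[of e] * \<open>d > 0\<close> by linarith
qed

text \<open>The triples encode forms of discriminant \<open>4 S\<close> with values \<open>a\<close>, \<open>- d\<close> and \<open>a - d + 2 e\<close> on a
  superbase. If the first and third are positive and odd, exchanging them is a fixed-point-free
  involution; otherwise passing to the two odd values gives a swap triple.\<close>

lemma even_card_skew_triples:
  assumes S: "S mod 4 = 1"
  shows "even (card (skew_triples S)) \<longleftrightarrow> even (card (swap_triples S))"
proof -
  have "odd S" using S by presburger
  define Pr where "Pr = (\<lambda>(a, d, e). even d \<and> a - d + 2 * e > (0::int))"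
  have "card (skew_triples S) = card {t \<in> skew_triples S. Pr t} + card {t \<in> skew_triples S. \<not> Pr t}"
    by (rule card_split[OF finite_skew_triples])
  moreover have "even (card {t \<in> skew_triples S. Pr t})"
  proof (rule even_card_fixpoint_free[where f = "\<lambda>(a, d, e). (a - d + 2 * e, d, d - e)"])
    fix t assume t: "t \<in> {t \<in> skew_triples S. Pr t}"
    obtain a d e where ade: "t = (a, d, e)" by (cases t)
    have *: "e * e + a * d = S" "odd a" "a > 0" "2 * e > - a" "d > a + e" "even d" "a - d + 2 * e > 0"
      using t by (simp_all add: ade skew_triples_def Pr_def)
    have "(d - e) * (d - e) + (a - d + 2 * e) * d = e * e + a * d" by (simp add: algebra_simps)
    \<comment> \<open>d = 2 e describes the fixed points of the exchange. There a and e are odd and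
      S = e^2 + 2 a e is 3 mod 4, a contradiction.\<close>
    moreover have "d \<noteq> 2 * e"
    proof
      assume d: "d = 2 * e"
      have "odd e" using *(1,6) \<open>odd S\<close> by auto
      then have "e * e mod 4 = 1" by (simp add: square_mod_4)
      moreover have "2 * (a * e) mod 4 = 2"
      proof -
        have "2 * k mod 4 = 2" if "odd k" for k :: int using that by presburger
        then show ?thesis using *(2) \<open>odd e\<close> by simp
      qed
      moreover have "S = e * e + 2 * (a * e)" using *(1) unfolding d by simp
      ultimately show False using S by presburger
    qed
    ultimately show "(\<lambda>(a, d, e). (a - d + 2 * e, d, d - e)) t \<in> {t \<in> skew_triples S. Pr t} \<and>
        (\<lambda>(a, d, e). (a - d + 2 * e, d, d - e)) ((\<lambda>(a, d, e). (a - d + 2 * e, d, d - e)) t) = t \<and>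
        (\<lambda>(a, d, e). (a - d + 2 * e, d, d - e)) t \<noteq> t"
      using * by (simp add: ade skew_triples_def Pr_def)
  qed (simp add: finite_skew_triples)
  \<comment> \<open>The sign of 2 f + p recovers the case: a + 2 e > 0 is kept when d is odd and
    negated by e -> - a - e when d is even.\<close>
  moreover have "card {t \<in> skew_triples S. \<not> Pr t} = card (swap_triples S)"
  proof (rule bij_betw_card_witness[where
        f = "\<lambda>(a, d, e). if odd d then (a, d, e) else (a, d - a - 2 * e, - a - e)" and
        g = "\<lambda>(p, n, f). if 2 * f > - p then (p, n, f) else (p, n - p - 2 * f, - f - p)"])
    fix t assume t: "t \<in> {t \<in> skew_triples S. \<not> Pr t}"
    obtain a d e where ade: "t = (a, d, e)" by (cases t)
    have *: "e * e + a * d = S" "odd a" "a > 0" "2 * e > - a" "d > a + e"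
      using t by (simp_all add: ade skew_triples_def)
    have "even e \<longleftrightarrow> odd d" using * \<open>odd S\<close> by auto
    show "(\<lambda>(a, d, e). if odd d then (a, d, e) else (a, d - a - 2 * e, - a - e)) t \<in> swap_triples S \<and>
      (\<lambda>(p, n, f). if 2 * f > - p then (p, n, f) else (p, n - p - 2 * f, - f - p))
        ((\<lambda>(a, d, e). if odd d then (a, d, e) else (a, d - a - 2 * e, - a - e)) t) = t"
    proof (cases "odd d")
      case True
      then have "even e" using \<open>even e \<longleftrightarrow> odd d\<close> by simp
      then show ?thesis using * True by (simp add: ade swap_triples_def add.commute)
    next
      case False
      then have "odd e" "d - a - 2 * e \<ge> 0" using \<open>even e \<longleftrightarrow> odd d\<close> t by (auto simp: ade Pr_def)
      moreover have "odd (d - a - 2 * e)" using False * by simp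
      moreover from this have "d - a - 2 * e \<noteq> 0" by (metis even_zero)
      moreover have "a * (d - a - 2 * e) + (- a - e) * (- a - e) = e * e + a * d" by (simp add: algebra_simps)
      ultimately show ?thesis using * False by (simp add: ade swap_triples_def)
    qed
  next
    fix t assume t: "t \<in> swap_triples S"
    obtain p n f where pnf: "t = (p, n, f)" by (cases t)
    have *: "p * n + f * f = S" "p > 0" "n > 0" "odd p" "odd n" "even f" "f + p < n"
      using t by (simp_all add: swap_triples_def pnf)
    show "(\<lambda>(p, n, f). if 2 * f > - p then (p, n, f) else (p, n - p - 2 * f, - f - p)) t \<in> {t \<in> skew_triples S. \<not> Pr t} \<and>
      (\<lambda>(a, d, e). if odd d then (a, d, e) else (a, d - a - 2 * e, - a - e))
        ((\<lambda>(p, n, f). if 2 * f > - p then (p, n, f) else (p, n - p - 2 * f, - f - p)) t) = t"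
    proof (cases "2 * f > - p")
      case True
      then show ?thesis using * by (simp add: pnf skew_triples_def Pr_def add.commute)
    next
      case False
      have "2 * f \<noteq> - p" using *(4) by (metis even_minus dvd_triv_left)
      then have "2 * f < - p" using False by simp
      moreover have "(- f - p) * (- f - p) + p * (n - p - 2 * f) = p * n + f * f" by (simp add: algebra_simps)
      ultimately show ?thesis using * False by (simp add: pnf skew_triples_def Pr_def)
    qed
  qed
  ultimately show ?thesis by simp
qed

text \<open>These arise from the solutions of a b + 3 c^2 = 12 S with a < b and 3 dividing a:
  replacing a by 3 a and dividing by 3 explains both the equation and the bound
  \<open>3 * a < b\<close>.\<close>

definition wide_triples :: "int \<Rightarrow> (int \<times> int \<times> int) set" where
  "wide_triples S = {(a, b, c). a * b + c * c = 4 * S \<and> a > 0 \<and> c > 0 \<and> odd a \<and> odd c \<and> 3 * a < b}"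

text \<open>The substitution c = a + 2 e, b = 4 d - a - 4 e turns c > 0 and b > 3 a into 2 e > - a
  and d > a + e. Integrality of d holds because 4 divides a (a + 4 e + b) and a is odd.\<close>

lemma card_wide_triples:
  assumes S: "S mod 4 = 1"
  shows "card (wide_triples S) = card (skew_triples S)"
proof (rule bij_betw_card_witness[where
      f = "\<lambda>(a, b, c). (a, (b - a + 2 * c) div 4, (c - a) div 2)" and
      g = "\<lambda>(a, d, e). (a, 4 * d - a - 4 * e, a + 2 * e)"])
  fix t assume t: "t \<in> wide_triples S"
  obtain a b c where abc: "t = (a, b, c)" by (cases t)
  have *: "a * b + c * c = 4 * S" "a > 0" "c > 0" "odd a" "odd c" "3 * a < b"
    using t by (simp_all add: abc wide_triples_def)
  obtain e where "c - a = 2 * e" using * by (metis evenE odd_even_add even_diff)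
  then have c: "c = a + 2 * e" by simp
  have "a * (a + 4 * e + b) = 4 * (S - e * e)" using *(1) unfolding c by (simp add: algebra_simps)
  then have "4 dvd a * (a + 4 * e + b)" by simp
  moreover have "coprime (4::int) a"
  proof -
    have "coprime (2 ^ 2) a" using *(4) by (simp only: coprime_power_left_iff coprime_left_2_iff_odd) simp
    then show ?thesis by simp
  qed
  ultimately have "4 dvd a + 4 * e + b" by (simp add: coprime_dvd_mult_right_iff)
  then obtain d where "a + 4 * e + b = 4 * d" by (rule dvdE)
  then have b: "b = 4 * d - a - 4 * e" by simp
  have "e * e + a * d = S" using *(1) unfolding b c by (simp add: algebra_simps)
  then show "(\<lambda>(a, b, c). (a, (b - a + 2 * c) div 4, (c - a) div 2)) t \<in> skew_triples S \<and>
      (\<lambda>(a, d, e). (a, 4 * d - a - 4 * e, a + 2 * e))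
        ((\<lambda>(a, b, c). (a, (b - a + 2 * c) div 4, (c - a) div 2)) t) = t"
    using * by (simp add: abc b c skew_triples_def)
next
  fix t assume t: "t \<in> skew_triples S"
  obtain a d e where ade: "t = (a, d, e)" by (cases t)
  have *: "e * e + a * d = S" "odd a" "a > 0" "2 * e > - a" "d > a + e"
    using t by (simp_all add: ade skew_triples_def)
  have "a * (4 * d - a - 4 * e) + (a + 2 * e) * (a + 2 * e) = 4 * (e * e + a * d)"
    by (simp add: algebra_simps)
  then have "(a, 4 * d - a - 4 * e, a + 2 * e) \<in> wide_triples S" using * by (simp add: wide_triples_def)
  then show "(\<lambda>(a, d, e). (a, 4 * d - a - 4 * e, a + 2 * e)) t \<in> wide_triples S \<and>
      (\<lambda>(a, b, c). (a, (b - a + 2 * c) div 4, (c - a) div 2))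
        ((\<lambda>(a, d, e). (a, 4 * d - a - 4 * e, a + 2 * e)) t) = t"
    by (simp add: ade)
qed

lemma even_card_wide_triples:
  assumes "S > 0" "S mod 4 = 1"
  shows "even (card (wide_triples S)) \<longleftrightarrow> even (card (short_reps S) + (if root_3_mod_4 S then 1 else 0))"
  using card_wide_triples[OF assms(2)] even_card_skew_triples[OF assms(2)] even_card_swap_triples[OF assms] by simp

section \<open>Representations of 4 S and S by u^2 + 3 d^2\<close>

definition odd_reps :: "int \<Rightarrow> (int \<times> int) set" where
  "odd_reps S = {(u, d). u * u + 3 * (d * d) = 4 * S \<and> odd u \<and> odd d \<and> u > 0 \<and> d > 0}"

definition pos_reps :: "int \<Rightarrow> (int \<times> int) set" where
  "pos_reps S = {(x, y). x * x + 3 * (y * y) = S \<and> x > 0 \<and> y > 0}"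

lemma finite_pos_reps: "finite (pos_reps S)"
proof (rule finite_int_pairs[of _ S])
  fix x y assume "(x, y) \<in> pos_reps S"
  then have "x * x + 3 * (y * y) = S" by (simp add: pos_reps_def)
  then show "\<bar>x\<bar> \<le> S \<and> \<bar>y\<bar> \<le> S"
    using abs_le_square[of x] abs_le_square[of y] by linarith
qed

lemma finite_odd_reps: "finite (odd_reps S)"
proof (rule finite_int_pairs[of _ "4 * S"])
  fix x y assume "(x, y) \<in> odd_reps S"
  then have "x * x + 3 * (y * y) = 4 * S" by (simp add: odd_reps_def)
  then show "\<bar>x\<bar> \<le> 4 * S \<and> \<bar>y\<bar> \<le> 4 * S"
    using abs_le_square[of x] abs_le_square[of y] by linarith
qed

lemma reps_parity:
  fixes x y :: int
  assumes "x * x + 3 * (y * y) = S" "S mod 4 = 3"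
  shows "even x \<and> odd y"
proof -
  have *: "X mod 4 = 0 \<and> Y mod 4 = 1"
    if "X + 3 * Y = S" "X mod 4 = 0 \<or> X mod 4 = 1" "Y mod 4 = 0 \<or> Y mod 4 = 1" for X Y :: int
    using that assms(2) by presburger
  have "x * x mod 4 = 0 \<and> y * y mod 4 = 1"
    by (rule *[OF assms(1)]) (simp_all add: square_mod_4)
  then show ?thesis by (simp add: square_mod_4 split: if_splits)
qed

text \<open>The unit group of the Eisenstein integers relates \<open>4 S = u\<^sup>2 + 3 d\<^sup>2\<close> with odd \<open>u, d\<close> to
  \<open>S = x\<^sup>2 + 3 y\<^sup>2\<close> via \<open>u = \<bar>x + 3 y\<bar>\<close>, \<open>d = \<bar>x - y\<bar>\<close>.\<close>

lemma card_odd_reps: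
  assumes S: "S mod 4 = 3"
  shows "card {(u, d) \<in> odd_reps S. g u} =
    card {y. y > 0 \<and> 3 * (y * y) = S \<and> g (3 * y)} +
    (card {(x, y) \<in> pos_reps S. g (x + 3 * y)} + card {(x, y) \<in> pos_reps S. g \<bar>x - 3 * y\<bar>})"
proof -
  define E where "E = {(x, y). x * x + 3 * (y * y) = S \<and> y > 0 \<and> g \<bar>x + 3 * y\<bar>}"
  have finE: "finite E"
  proof (rule finite_int_pairs[of _ S])
    fix x y assume "(x, y) \<in> E"
    then have "x * x + 3 * (y * y) = S" by (simp add: E_def)
    then show "\<bar>x\<bar> \<le> S \<and> \<bar>y\<bar> \<le> S"
      using abs_le_square[of x] abs_le_square[of y] by linarith
  qed
  have inj: "(x, y) = (x', y')"
    if xy: "(x, y) \<in> E" "(x', y') \<in> E" and eq: "\<bar>x + 3 * y\<bar> = \<bar>x' + 3 * y'\<bar>" "\<bar>x - y\<bar> = \<bar>x' - y'\<bar>"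
    for x y x' y'
  proof -
    have p: "even x" "odd y" "even x'" "odd y'" "y > 0" "y' > 0"
      using xy reps_parity[OF _ S] by (auto simp: E_def)
    then have "odd (x' + y')" by simp
    \<comment> \<open>If the two absolute values are resolved with opposite signs, then 2 y equals
      x' + y' or its negative, impossible by parity. Equal signs give the same pair or its negative,
      and the latter violates y, y' > 0.\<close>
    then have "2 * y \<noteq> x' + y'" "2 * y \<noteq> - (x' + y')" by (metis dvd_triv_left, metis dvd_triv_left even_minus)
    moreover have "x + 3 * y = x' + 3 * y' \<or> x + 3 * y = - (x' + 3 * y')" "x - y = x' - y' \<or> x - y = - (x' - y')"
      using eq by linarith+
    ultimately have "x = x' \<and> y = y'" using p(5,6) by linarith
    then show ?thesis by simp
  qed
  have "bij_betw (\<lambda>(x, y). (\<bar>x + 3 * y\<bar>, \<bar>x - y\<bar>)) E {(u, d) \<in> odd_reps S. g u}"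
  proof (rule bij_betw_imageI)
    show "inj_on (\<lambda>(x, y). (\<bar>x + 3 * y\<bar>, \<bar>x - y\<bar>)) E"
    proof (rule inj_onI)
      fix s t assume st: "s \<in> E" "t \<in> E"
        "(\<lambda>(x, y). (\<bar>x + 3 * y\<bar>, \<bar>x - y\<bar>)) s = (\<lambda>(x, y). (\<bar>x + 3 * y\<bar>, \<bar>x - y\<bar>)) t"
      obtain x y x' y' where "s = (x, y)" "t = (x', y')" by (cases s, cases t)
      with st inj[of x y x' y'] show "s = t" by simp
    qed
    show "(\<lambda>(x, y). (\<bar>x + 3 * y\<bar>, \<bar>x - y\<bar>)) ` E = {(u, d) \<in> odd_reps S. g u}"
    proof (intro equalityI subsetI)
      fix t assume "t \<in> (\<lambda>(x, y). (\<bar>x + 3 * y\<bar>, \<bar>x - y\<bar>)) ` E"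
      then obtain x y where t: "t = (\<bar>x + 3 * y\<bar>, \<bar>x - y\<bar>)" and xy: "x * x + 3 * (y * y) = S" "g \<bar>x + 3 * y\<bar>"
        by (auto simp: E_def)
      have "even x \<and> odd y" by (rule reps_parity[OF xy(1) S])
      then have o: "odd (x + 3 * y)" "odd (x - y)" by simp_all
      then have "x + 3 * y \<noteq> 0" "x - y \<noteq> 0" by (metis even_zero)+
      moreover have "(x + 3 * y) * (x + 3 * y) + 3 * ((x - y) * (x - y)) = 4 * S"
        unfolding xy(1)[symmetric] by (simp add: algebra_simps)
      ultimately show "t \<in> {(u, d) \<in> odd_reps S. g u}"
        using o xy(2) by (simp add: t odd_reps_def)
    next
      fix t assume t: "t \<in> {(u, d) \<in> odd_reps S. g u}"
      obtain u d where ud: "t = (u, d)" by (cases t)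
      have *: "u * u + 3 * (d * d) = 4 * S" "odd u" "odd d" "u > 0" "d > 0" "g u"
        using t by (simp_all add: ud odd_reps_def)
      \<comment> \<open>For odd u and d, 4 divides u - d or u + d. The sign of d is chosen so that y
        = (u - d') / 4 is an integer; then x = d' + y, and the pair is negated if y < 0.\<close>
      define d' where "d' = (if 4 dvd u - d then d else - d)"
      have "4 dvd u - d'"
      proof -
        have "odd u \<Longrightarrow> odd d \<Longrightarrow> \<not> 4 dvd u - d \<Longrightarrow> 4 dvd u + d" by presburger
        then show ?thesis using * by (simp add: d'_def)
      qed
      then obtain y where "u - d' = 4 * y" by (rule dvdE)
      then have u: "u = d' + 4 * y" by simp
      have d': "\<bar>d'\<bar> = d" "d' * d' = d * d" using *(5) by (simp_all add: d'_def)
      have "4 * ((d' + y) * (d' + y) + 3 * (y * y)) = u * u + 3 * (d' * d')"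
        unfolding u by (simp add: algebra_simps)
      then have S': "(d' + y) * (d' + y) + 3 * (y * y) = S" using *(1) d'(2) by simp
      have "odd y" using reps_parity[OF S' S] by simp
      then have "y \<noteq> 0" by (metis even_zero)
      define x0 where "x0 = (if y > 0 then d' + y else - d' - y)"
      have "(x0, \<bar>y\<bar>) \<in> E \<and> t = (\<bar>x0 + 3 * \<bar>y\<bar>\<bar>, \<bar>x0 - \<bar>y\<bar>\<bar>)"
      proof (cases "y > 0")
        case True
        then have "x0 + 3 * \<bar>y\<bar> = u" "x0 - \<bar>y\<bar> = d'" "x0 * x0 = (d' + y) * (d' + y)"
          by (simp_all add: x0_def u)
        then show ?thesis using S' True *(4,6) d'(1) by (simp add: E_def ud)
      next
        case False
        then have "x0 + 3 * \<bar>y\<bar> = - u" "x0 - \<bar>y\<bar> = - d'" "x0 * x0 = (d' + y) * (d' + y)"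
          by (simp_all add: x0_def u algebra_simps)
        then show ?thesis using S' False \<open>y \<noteq> 0\<close> *(4,6) d'(1) by (simp add: E_def ud)
      qed
      then show "t \<in> (\<lambda>(x, y). (\<bar>x + 3 * y\<bar>, \<bar>x - y\<bar>)) ` E"
        by (intro image_eqI[where x = "(x0, \<bar>y\<bar>)"]) simp_all
    qed
  qed
  then have "card {(u, d) \<in> odd_reps S. g u} = card E" by (rule bij_betw_same_card[symmetric])
  also have "card E = card {t \<in> E. fst t = 0} + card {t \<in> E. \<not> fst t = 0}"
    by (rule card_split[OF finE])
  also have "card {t \<in> E. \<not> fst t = 0} = card {t \<in> {t \<in> E. \<not> fst t = 0}. fst t > 0} +
      card {t \<in> {t \<in> E. \<not> fst t = 0}. \<not> fst t > 0}"
    by (rule card_split) (simp add: finE)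
  also have "card {t \<in> E. fst t = 0} = card {y. y > 0 \<and> 3 * (y * y) = S \<and> g (3 * y)}"
  proof (rule bij_betw_card_witness[where f = snd and g = "\<lambda>y. (0, y)"])
    fix t assume t: "t \<in> {t \<in> E. fst t = 0}"
    obtain x y where xy: "t = (x, y)" by (cases t)
    have "x = 0" "y > 0" using t by (simp_all add: xy E_def)
    then have "\<bar>x + 3 * y\<bar> = 3 * y" by simp
    then show "snd t \<in> {y. y > 0 \<and> 3 * (y * y) = S \<and> g (3 * y)} \<and> (0, snd t) = t"
      using t \<open>x = 0\<close> by (simp add: xy E_def)
  qed (simp add: E_def)
  also have "{t \<in> {t \<in> E. \<not> fst t = 0}. fst t > 0} = {(x, y) \<in> pos_reps S. g (x + 3 * y)}"
  proof -
    have "(x, y) \<in> {t \<in> {t \<in> E. \<not> fst t = 0}. fst t > 0} \<longleftrightarrow>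
        (x, y) \<in> {(x, y) \<in> pos_reps S. g (x + 3 * y)}" for x y
    proof (cases "x > 0 \<and> y > 0")
      case True
      then have "\<bar>x + 3 * y\<bar> = x + 3 * y" by simp
      then show ?thesis using True by (simp add: E_def pos_reps_def)
    qed (auto simp: E_def pos_reps_def)
    then have "t \<in> {t \<in> {t \<in> E. \<not> fst t = 0}. fst t > 0} \<longleftrightarrow>
        t \<in> {(x, y) \<in> pos_reps S. g (x + 3 * y)}" for t
      by (cases t) (simp only:)
    then show ?thesis by (rule Set.set_eqI)
  qed
  also have "card {t \<in> {t \<in> E. \<not> fst t = 0}. \<not> fst t > 0} = card {(x, y) \<in> pos_reps S. g \<bar>x - 3 * y\<bar>}"
  proof (rule bij_betw_card_witness[where f = "\<lambda>(x, y). (- x, y)" and g = "\<lambda>(x, y). (- x, y)"])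
    have *: "\<bar>- x - 3 * y\<bar> = \<bar>x + 3 * y\<bar>" "\<bar>- x + 3 * y\<bar> = \<bar>x - 3 * y\<bar>" for x y :: int
      by linarith+
    fix t :: "int \<times> int"
    obtain x y where t: "t = (x, y)" by (cases t)
    show "(\<lambda>(x, y). (- x, y)) t \<in> {(x, y) \<in> pos_reps S. g \<bar>x - 3 * y\<bar>} \<and>
        (\<lambda>(x, y). (- x, y)) ((\<lambda>(x, y). (- x, y)) t) = t"
      if "t \<in> {t \<in> {t \<in> E. \<not> fst t = 0}. \<not> fst t > 0}"
      using that * by (simp add: t E_def pos_reps_def)
    show "(\<lambda>(x, y). (- x, y)) t \<in> {t \<in> {t \<in> E. \<not> fst t = 0}. \<not> fst t > 0} \<and>
        (\<lambda>(x, y). (- x, y)) ((\<lambda>(x, y). (- x, y)) t) = t"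
      if "t \<in> {(x, y) \<in> pos_reps S. g \<bar>x - 3 * y\<bar>}"
      using that * by (simp add: t E_def pos_reps_def)
  qed
  finally show ?thesis .
qed

definition thrice_square :: "int \<Rightarrow> bool" where
  "thrice_square S \<longleftrightarrow> (\<exists>y>0. 3 * (y * y) = S)"

lemma card_thrice_square:
  fixes S :: int
  shows
  "card {y. y > 0 \<and> 3 * (y * y) = S \<and> g y} = (if \<exists>y>0. 3 * (y * y) = S \<and> g y then 1 else 0)"
proof (cases "\<exists>y>0. 3 * (y * y) = S \<and> g y")
  case True
  then obtain y where y: "y > 0" "3 * (y * y) = S" "g y" by blast
  have "{y. y > 0 \<and> 3 * (y * y) = S \<and> g y} = {y}"
  proof (intro equalityI subsetI)
    fix z assume "z \<in> {y. y > 0 \<and> 3 * (y * y) = S \<and> g y}"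
    then have "z > 0" "z * z = y * y" using y(2) by simp_all
    then have "z = y" using y(1) square_inj_pos by blast
    then show "z \<in> {y}" by simp
  qed (use y in simp)
  then show ?thesis using True by simp
next
  case False
  then have e: "{y. y > 0 \<and> 3 * (y * y) = S \<and> g y} = {}" by blast
  show ?thesis unfolding e using False by (simp only: if_False card.empty)
qed

text \<open>Without a filter, x > 0 and x < 0 each contribute all of \<open>pos_reps\<close>; modulo
  2 only x = 0 survives, which is S = 3 y^2.\<close>

lemma even_card_odd_reps:
  assumes "S mod 4 = 3"
  shows "even (card (odd_reps S)) \<longleftrightarrow> \<not> thrice_square S"
proof -
  have "{(u, d) \<in> odd_reps S. True} = odd_reps S" "{(x, y) \<in> pos_reps S. True} = pos_reps S" by auto
  then have "card (odd_reps S) = card {y. y > 0 \<and> 3 * (y * y) = S \<and> True} + (card (pos_reps S) + card (pos_reps S))"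
    using card_odd_reps[OF assms, of "\<lambda>_. True"] by simp
  then show ?thesis
    unfolding card_thrice_square[of S "\<lambda>_. True"] by (simp add: thrice_square_def)
qed

section \<open>Parity of the number of Lambert triples\<close>

lemma even_sum_cong:
  fixes f g :: "'a \<Rightarrow> nat"
  assumes "\<And>x. x \<in> A \<Longrightarrow> even (f x) \<longleftrightarrow> even (g x)"
  shows "even (sum f A) \<longleftrightarrow> even (sum g A)"
  using assms by (induction A rule: infinite_finite_induct) auto

lemma card_filter_eq_sum: "finite A \<Longrightarrow> card {x \<in> A. Pr x} = (\<Sum>x\<in>A. if Pr x then 1 else 0)"
  by (simp add: sum.If_cases Int_def)

definition lambert_triples :: "int \<Rightarrow> (int \<times> int \<times> int) set" where
  "lambert_triples S = {(a, b, c). a * b + 3 * (c * c) = 4 * S \<and> a > 0 \<and> c > 0 \<and> odd c \<and>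
     (a mod 6 = 1 \<and> a < b \<or> a mod 6 = 5 \<and> a \<le> b)}"

definition ordered_triples :: "int \<Rightarrow> (int \<times> int \<times> int) set" where
  "ordered_triples S = {(a, b, c). a * b + 3 * (c * c) = 4 * S \<and> a > 0 \<and> c > 0 \<and> odd c \<and> a < b}"

lemma ternary_bound:
  fixes a b c N :: int
  assumes "a * b + 3 * (c * c) = N" "a > 0" "b > 0"
  shows "\<bar>a\<bar> \<le> N \<and> \<bar>b\<bar> \<le> N \<and> \<bar>c\<bar> \<le> N"
proof -
  have "a \<le> a * b" "b \<le> a * b" using assms by (auto intro: le_mult_pos)
  then show ?thesis using abs_le_square[of c] assms by linarith
qed

lemma finite_lambert_triples: "finite (lambert_triples S)"
proof (rule finite_int_triples)
  fix a b c assume "(a, b, c) \<in> lambert_triples S"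
  then show "\<bar>a\<bar> \<le> 4 * S \<and> \<bar>b\<bar> \<le> 4 * S \<and> \<bar>c\<bar> \<le> 4 * S"
    by (intro ternary_bound) (auto simp: lambert_triples_def)
qed

lemma finite_ordered_triples: "finite (ordered_triples S)"
proof (rule finite_int_triples)
  fix a b c assume "(a, b, c) \<in> ordered_triples S"
  then show "\<bar>a\<bar> \<le> 4 * S \<and> \<bar>b\<bar> \<le> 4 * S \<and> \<bar>c\<bar> \<le> 4 * S"
    by (intro ternary_bound) (auto simp: ordered_triples_def)
qed

lemma odd_of_eq:
  fixes a b c S :: int
  assumes "a * b + 3 * (c * c) = 4 * S" "odd c"
  shows "odd a \<and> odd b"
proof -
  have "even (a * b + 3 * (c * c))" unfolding assms(1) by simp
  then show ?thesis using assms(2) by simp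
qed

text \<open>Since a is odd, a mod 6 = 1 or 5 means that 3 does not divide a. The triples with b = a
  are solutions of u^2 + 3 d^2 = 4 S. The others lie in \<open>ordered_triples\<close>, a set that
  ignores residues mod 6, so that the results on factor pairs apply to it.\<close>

lemma card_lambert_triples:
  "card (lambert_triples S) = card {(u, d) \<in> odd_reps S. u mod 6 = 5} + card {t \<in> ordered_triples S. \<not> 3 dvd fst t}"
proof -
  have "card (lambert_triples S) = card {t \<in> lambert_triples S. fst t = fst (snd t)} + card {t \<in> lambert_triples S. \<not> fst t = fst (snd t)}"
    by (rule card_split[OF finite_lambert_triples])
  also have "card {t \<in> lambert_triples S. fst t = fst (snd t)} = card {(u, d) \<in> odd_reps S. u mod 6 = 5}"
  proof (rule bij_betw_card_witness[where f = "\<lambda>(a, b, c). (a, c)" and g = "\<lambda>(u, d). (u, u, d)"])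
    fix t assume t: "t \<in> {t \<in> lambert_triples S. fst t = fst (snd t)}"
    obtain a b c where abc: "t = (a, b, c)" by (cases t)
    have b: "b = a" using t by (simp add: abc)
    have "(a, b, c) \<in> lambert_triples S" using t unfolding abc by blast
    then have "a * b + 3 * (c * c) = 4 * S" "odd c" by (simp_all add: lambert_triples_def)
    then have "odd a" using odd_of_eq by blast
    then show "(\<lambda>(a, b, c). (a, c)) t \<in> {(u, d) \<in> odd_reps S. u mod 6 = 5} \<and>
        (\<lambda>(u, d). (u, u, d)) ((\<lambda>(a, b, c). (a, c)) t) = t"
      using t by (simp add: abc b lambert_triples_def odd_reps_def)
  next
    fix t assume t: "t \<in> {(u, d) \<in> odd_reps S. u mod 6 = 5}"
    obtain u d where ud: "t = (u, d)" by (cases t)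
    show "(\<lambda>(u, d). (u, u, d)) t \<in> {t \<in> lambert_triples S. fst t = fst (snd t)} \<and>
        (\<lambda>(a, b, c). (a, c)) ((\<lambda>(u, d). (u, u, d)) t) = t"
      using t by (simp add: ud lambert_triples_def odd_reps_def)
  qed
  also have "{t \<in> lambert_triples S. \<not> fst t = fst (snd t)} = {t \<in> ordered_triples S. \<not> 3 dvd fst t}"
  proof (rule Set.set_eqI)
    fix t :: "int \<times> int \<times> int"
    obtain a b c where abc: "t = (a, b, c)" by (cases t)
    have "odd a" if "a * b + 3 * (c * c) = 4 * S" "odd c"
      using odd_of_eq[OF that] by simp
    moreover have "a mod 6 = 1 \<or> a mod 6 = 5 \<longleftrightarrow> odd a \<and> \<not> 3 dvd a" by presburger
    ultimately show "t \<in> {t \<in> lambert_triples S. \<not> fst t = fst (snd t)} \<longleftrightarrow> t \<in> {t \<in> ordered_triples S. \<not> 3 dvd fst t}"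
      unfolding abc lambert_triples_def ordered_triples_def by (simp del: even_mult_iff) linarith
  qed
  finally show ?thesis .
qed

text \<open>For fixed odd c the factor pairs of 4 S - 3 c^2, which is 1 mod 4, are traded for sums
  p^2 + h^2 and a root term. The root terms collect the solutions of u^2 + 3 c^2 = 4 S with u = 3
  mod 4. Fixing h = 2 x instead of c, the other solutions satisfy p^2 + 3 c^2 = 4 (S - x^2); by
  \<open>even_card_odd_reps\<close> only S - x^2 = 3 y^2 counts, which gives
  \<open>pos_reps\<close>.\<close>

lemma even_card_ordered_triples:
  assumes S: "S mod 4 = 3"
  shows "even (card (ordered_triples S)) \<longleftrightarrow>
    even (card (pos_reps S) + card {(u, d) \<in> odd_reps S. u mod 4 = 3})"
proof -
  define C where "C = {c. odd c \<and> 0 < c \<and> 3 * (c * c) < 4 * S}"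
  define X where "X = {x. even x \<and> 0 < x \<and> x * x < S}"
  have "C \<subseteq> {0..4 * S}" "X \<subseteq> {0..S}"
  proof -
    have "c \<in> {0..4 * S}" if "c \<in> C" for c
    proof -
      have "c > 0" "3 * (c * c) < 4 * S" using that by (simp_all add: C_def)
      then have "c \<le> 4 * S" using abs_le_square[of c] by linarith
      then show ?thesis using \<open>c > 0\<close> by simp
    qed
    then show "C \<subseteq> {0..4 * S}" by blast
    have "x \<in> {0..S}" if "x \<in> X" for x
    proof -
      have "x > 0" "x * x < S" using that by (simp_all add: X_def)
      then have "x \<le> S" using abs_le_square[of x] by linarith
      then show ?thesis using \<open>x > 0\<close> by simp
    qed
    then show "X \<subseteq> {0..S}" by blast
  qed
  then have finC: "finite C" and finX: "finite X" by (auto intro: finite_subset)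
  have oddS: "odd S" using S by presburger
  have "card (ordered_triples S) = card (SIGMA c:C. factor_pairs (4 * S - 3 * (c * c)))"
  proof (rule bij_betw_card_witness[where f = "\<lambda>(a, b, c). (c, (a, b))" and g = "\<lambda>(c, (a, b)). (a, b, c)"])
    fix t assume t: "t \<in> ordered_triples S"
    obtain a b c where abc: "t = (a, b, c)" by (cases t)
    have *: "a * b + 3 * (c * c) = 4 * S" "a > 0" "c > 0" "odd c" "a < b"
      using t by (simp_all add: abc ordered_triples_def)
    then have "a * b > 0" by simp
    then have "3 * (c * c) < 4 * S" using *(1) by linarith
    then have "c \<in> C" using *(3,4) by (simp add: C_def)
    moreover have "a * b = 4 * S - 3 * (c * c)" using * by simp
    ultimately show "(\<lambda>(a, b, c). (c, (a, b))) t \<in> (SIGMA c:C. factor_pairs (4 * S - 3 * (c * c))) \<and>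
        (\<lambda>(c, (a, b)). (a, b, c)) ((\<lambda>(a, b, c). (c, (a, b))) t) = t"
      using * by (simp add: abc factor_pairs_def)
  next
    fix t assume t: "t \<in> (SIGMA c:C. factor_pairs (4 * S - 3 * (c * c)))"
    obtain c a b where cab: "t = (c, (a, b))" by (cases t) auto
    show "(\<lambda>(c, (a, b)). (a, b, c)) t \<in> ordered_triples S \<and>
        (\<lambda>(a, b, c). (c, (a, b))) ((\<lambda>(c, (a, b)). (a, b, c)) t) = t"
      using t by (simp add: cab ordered_triples_def factor_pairs_def C_def)
  qed
  also have "\<dots> = (\<Sum>c\<in>C. card (factor_pairs (4 * S - 3 * (c * c))))"
    by (rule card_SigmaI) (simp_all add: finC finite_factor_pairs)
  also have "even \<dots> \<longleftrightarrow> even (\<Sum>c\<in>C. card (two_squares (4 * S - 3 * (c * c))) +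
      (if root_3_mod_4 (4 * S - 3 * (c * c)) then 1 else 0))"
  proof (rule even_sum_cong)
    fix c assume c: "c \<in> C"
    then have "c * c mod 4 = 1" by (simp add: C_def square_mod_4)
    then have "(4 * S - 3 * (c * c)) mod 4 = 1" by presburger
    then show "even (card (factor_pairs (4 * S - 3 * (c * c)))) \<longleftrightarrow>
        even (card (two_squares (4 * S - 3 * (c * c))) + (if root_3_mod_4 (4 * S - 3 * (c * c)) then 1 else 0))"
      using c by (intro even_card_factor_pairs) (simp_all add: C_def)
  qed
  also have "(\<Sum>c\<in>C. card (two_squares (4 * S - 3 * (c * c))) + (if root_3_mod_4 (4 * S - 3 * (c * c)) then 1 else 0)) =
      card (SIGMA c:C. two_squares (4 * S - 3 * (c * c))) + card {c \<in> C. root_3_mod_4 (4 * S - 3 * (c * c))}"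
    by (simp only: sum.distrib card_filter_eq_sum[OF finC] card_SigmaI[OF finC ballI[OF finite_two_squares]])
  also have "card {c \<in> C. root_3_mod_4 (4 * S - 3 * (c * c))} = card {(u, d) \<in> odd_reps S. u mod 4 = 3}"
  proof -
    have "{c \<in> C. root_3_mod_4 (4 * S - 3 * (c * c))} = snd ` {(u, d) \<in> odd_reps S. u mod 4 = 3}"
    proof (intro equalityI subsetI)
      fix c assume c: "c \<in> {c \<in> C. root_3_mod_4 (4 * S - 3 * (c * c))}"
      then obtain w where w: "w > 0" "w * w = 4 * S - 3 * (c * c)" "w mod 4 = 3"
        by (auto simp: root_3_mod_4_def)
      have "odd w" using w(3) by presburger
      then have "(w, c) \<in> {(u, d) \<in> odd_reps S. u mod 4 = 3}"
        using w c by (simp add: odd_reps_def C_def)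
      then show "c \<in> snd ` {(u, d) \<in> odd_reps S. u mod 4 = 3}"
        by (intro image_eqI[where x = "(w, c)"]) simp_all
    next
      fix c assume "c \<in> snd ` {(u, d) \<in> odd_reps S. u mod 4 = 3}"
      then obtain u where u: "(u, c) \<in> odd_reps S" "u mod 4 = 3" by auto
      have *: "u * u + 3 * (c * c) = 4 * S" "odd c" "u > 0" "c > 0"
        using u(1) by (simp_all add: odd_reps_def)
      have "u * u > 0" using *(3) by simp
      then have "3 * (c * c) < 4 * S" using *(1) by linarith
      then have "c \<in> C" using *(2,4) by (simp add: C_def)
      moreover have "root_3_mod_4 (4 * S - 3 * (c * c))"
        unfolding root_3_mod_4_def using *(1,3) u(2) by (intro exI[of _ u]) simp
      ultimately show "c \<in> {c \<in> C. root_3_mod_4 (4 * S - 3 * (c * c))}" by simp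
    qed
    moreover have "inj_on snd {(u, d) \<in> odd_reps S. u mod 4 = 3}"
    proof (rule inj_onI)
      fix s t assume st: "s \<in> {(u, d) \<in> odd_reps S. u mod 4 = 3}"
        "t \<in> {(u, d) \<in> odd_reps S. u mod 4 = 3}" "snd s = snd t"
      obtain u d u' d' where s: "s = (u, d)" and t: "t = (u', d')" by (cases s, cases t)
      have "u * u + 3 * (d * d) = u' * u' + 3 * (d' * d')" "u > 0" "u' > 0" "d' = d"
        using st by (simp_all add: s t odd_reps_def)
      then have "u * u = u' * u'" by simp
      then have "u = u'" using \<open>u > 0\<close> \<open>u' > 0\<close> by (rule square_inj_pos)
      then show "s = t" using \<open>d' = d\<close> by (simp add: s t)
    qed
    ultimately show ?thesis by (simp add: card_image)
  qed
  also have "card (SIGMA c:C. two_squares (4 * S - 3 * (c * c))) = card (SIGMA x:X. odd_reps (S - x * x))"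
  proof (rule bij_betw_card_witness[where f = "\<lambda>(c, (p, h)). (h div 2, (p, c))" and
        g = "\<lambda>(x, (u, d)). (d, (u, 2 * x))"])
    fix t assume t: "t \<in> (SIGMA c:C. two_squares (4 * S - 3 * (c * c)))"
    obtain c p h where cph: "t = (c, (p, h))" by (cases t) auto
    have *: "p * p + h * h = 4 * S - 3 * (c * c)" "0 < p" "0 < h" "even h" "odd c" "c > 0"
      using t by (simp_all add: cph two_squares_def C_def)
    obtain x where h: "h = 2 * x" using *(4) by (rule evenE)
    have p: "p * p + 3 * (c * c) = 4 * (S - x * x)" using *(1) unfolding h by simp
    have "odd p" using odd_of_eq[OF p *(5)] by simp
    \<comment> \<open>Odd squares are 1 mod 8, so 4 (S - x^2) is 4 mod 8 and S - x^2 is odd; this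
      makes x even and S - x^2 = 3 mod 4.\<close>
    have "p * p mod 8 = 1" "c * c mod 8 = 1" using \<open>odd p\<close> \<open>odd c\<close> by (simp_all add: odd_square_mod_8)
    then have "odd (S - x * x)" using p by presburger
    then have "even x" using oddS by simp
    moreover have "p * p > 0" "c * c > 0" using * by simp_all
    then have "4 * (x * x) < 4 * S" using p unfolding right_diff_distrib by linarith
    then have "x * x < S" by simp
    ultimately show "(\<lambda>(c, (p, h)). (h div 2, (p, c))) t \<in> (SIGMA x:X. odd_reps (S - x * x)) \<and>
        (\<lambda>(x, (u, d)). (d, (u, 2 * x))) ((\<lambda>(c, (p, h)). (h div 2, (p, c))) t) = t"
      using * p \<open>odd p\<close> by (simp add: cph h X_def odd_reps_def)
  next
    fix t assume t: "t \<in> (SIGMA x:X. odd_reps (S - x * x))"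
    obtain x u d where xud: "t = (x, (u, d))" by (cases t) auto
    have *: "u * u + 3 * (d * d) = 4 * (S - x * x)" "odd d" "u > 0" "d > 0" "x > 0"
      using t by (simp_all add: xud odd_reps_def X_def)
    have "u * u > 0" using * by simp
    moreover have "x * x > 0" using * by simp
    ultimately have "3 * (d * d) < 4 * S" using *(1) unfolding right_diff_distrib by linarith
    then show "(\<lambda>(x, (u, d)). (d, (u, 2 * x))) t \<in> (SIGMA c:C. two_squares (4 * S - 3 * (c * c))) \<and>
        (\<lambda>(c, (p, h)). (h div 2, (p, c))) ((\<lambda>(x, (u, d)). (d, (u, 2 * x))) t) = t"
      using * by (simp add: xud C_def two_squares_def)
  qed
  also have "card (SIGMA x:X. odd_reps (S - x * x)) = (\<Sum>x\<in>X. card (odd_reps (S - x * x)))"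
    by (rule card_SigmaI) (simp_all add: finX finite_odd_reps)
  also have "even ((\<Sum>x\<in>X. card (odd_reps (S - x * x))) + card {(u, d) \<in> odd_reps S. u mod 4 = 3}) \<longleftrightarrow>
      even ((\<Sum>x\<in>X. if thrice_square (S - x * x) then 1 else 0 :: nat) + card {(u, d) \<in> odd_reps S. u mod 4 = 3})"
  proof -
    have "even (\<Sum>x\<in>X. card (odd_reps (S - x * x))) \<longleftrightarrow>
        even (\<Sum>x\<in>X. if thrice_square (S - x * x) then 1 else 0 :: nat)"
    proof (rule even_sum_cong)
      fix x assume "x \<in> X"
      then have "x * x mod 4 = 0" by (simp add: X_def square_mod_4)
      then have "(S - x * x) mod 4 = 3" using S by presburger
      then show "even (card (odd_reps (S - x * x))) \<longleftrightarrow> even (if thrice_square (S - x * x) then 1 else 0 :: nat)"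
        by (simp add: even_card_odd_reps)
    qed
    then show ?thesis by simp
  qed
  also have "(\<Sum>x\<in>X. if thrice_square (S - x * x) then 1 else 0 :: nat) = card {x \<in> X. thrice_square (S - x * x)}"
    by (rule card_filter_eq_sum[OF finX, symmetric])
  also have "{x \<in> X. thrice_square (S - x * x)} = fst ` pos_reps S"
  proof (intro equalityI subsetI)
    fix x assume x: "x \<in> {x \<in> X. thrice_square (S - x * x)}"
    then obtain y where "y > 0" "3 * (y * y) = S - x * x" by (auto simp: thrice_square_def)
    then have "(x, y) \<in> pos_reps S" using x by (simp add: pos_reps_def X_def)
    then show "x \<in> fst ` pos_reps S" by (intro image_eqI[where x = "(x, y)"]) simp_all
  next
    fix x assume "x \<in> fst ` pos_reps S"
    then obtain y where "(x, y) \<in> pos_reps S" by auto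
    then have y: "x * x + 3 * (y * y) = S" "x > 0" "y > 0" by (simp_all add: pos_reps_def)
    have "even x" using reps_parity[OF y(1) S] by simp
    moreover have "y * y > 0" using y(3) by simp
    then have "x * x < S" using y(1) by linarith
    moreover have "thrice_square (S - x * x)"
      unfolding thrice_square_def using y by (intro exI[of _ y]) simp
    ultimately show "x \<in> {x \<in> X. thrice_square (S - x * x)}" using y(2) by (simp add: X_def)
  qed
  also have "card (fst ` pos_reps S) = card (pos_reps S)"
  proof (rule card_image, rule inj_onI)
    fix s t assume st: "s \<in> pos_reps S" "t \<in> pos_reps S" "fst s = fst t"
    obtain x y x' y' where s: "s = (x, y)" and t: "t = (x', y')" by (cases s, cases t)
    have "x * x + 3 * (y * y) = x' * x' + 3 * (y' * y')" "y > 0" "y' > 0" "x' = x"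
      using st by (simp_all add: s t pos_reps_def)
    then have "y * y = y' * y'" by simp
    then have "y = y'" using \<open>y > 0\<close> \<open>y' > 0\<close> by (rule square_inj_pos)
    then show "s = t" using \<open>x' = x\<close> by (simp add: s t)
  qed
  finally show ?thesis .
qed

text \<open>Both numbers are odd. They differ by 6 y, which is 2 mod 4, if x > 3 y, and by 2 x, a
  multiple of 4, if x < 3 y.\<close>

lemma mod_4_sign_parity:
  fixes x y :: int
  assumes "even x" "odd y"
  shows "((x + 3 * y) mod 4 = 3) \<noteq> (\<bar>x - 3 * y\<bar> mod 4 = 3) \<longleftrightarrow> x > 3 * y"
proof -
  have "odd (x + 3 * y)" using assms by simp
  have "x \<noteq> 3 * y" using assms by auto
  then consider "x > 3 * y" | "x < 3 * y" by linarith
  then show ?thesis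
  proof cases
    case 1
    obtain k where "y = 2 * k + 1" using assms(2) by (rule oddE)
    then have "\<bar>x - 3 * y\<bar> = (x + 3 * y) - 12 * k - 6" using 1 by simp
    moreover have "(p mod 4 = 3) \<noteq> ((p - 12 * k - 6) mod 4 = 3)" if "odd p" for p :: int
      using that by presburger
    ultimately have "((x + 3 * y) mod 4 = 3) \<noteq> (\<bar>x - 3 * y\<bar> mod 4 = 3)"
      using \<open>odd (x + 3 * y)\<close> by metis
    then show ?thesis using 1 by simp
  next
    case 2
    obtain k where "x = 2 * k" using assms(1) by (rule evenE)
    then have "\<bar>x - 3 * y\<bar> = (x + 3 * y) - 4 * k" using 2 by simp
    moreover have "(p mod 4 = 3) = ((p - 4 * k) mod 4 = 3)" for p :: int
      by presburger
    ultimately have "((x + 3 * y) mod 4 = 3) = (\<bar>x - 3 * y\<bar> mod 4 = 3)" by metis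
    then show ?thesis using 2 by simp
  qed
qed

text \<open>A shift by 6 y preserves residues mod 6, whereas the reflection p -> 6 y - p exchanges 1
  and 5. The outcome is complementary to \<open>mod_4_sign_parity\<close>, so the two conditions
  together count each (x, y) an odd number of times.\<close>

lemma mod_6_sign_parity:
  fixes x y :: int
  assumes "even x" "odd y" "\<not> 3 dvd x"
  shows "((x + 3 * y) mod 6 = 5) \<noteq> (\<bar>x - 3 * y\<bar> mod 6 = 5) \<longleftrightarrow> \<not> x > 3 * y"
proof (cases "x > 3 * y")
  case True
  then have "\<bar>x - 3 * y\<bar> = (x + 3 * y) - 6 * y" by simp
  moreover have "(p mod 6 = 5) = ((p - 6 * y) mod 6 = 5)" for p :: int
    by presburger
  ultimately have "((x + 3 * y) mod 6 = 5) = (\<bar>x - 3 * y\<bar> mod 6 = 5)" by metis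
  then show ?thesis using True by simp
next
  case False
  have "odd (x + 3 * y)" "\<not> 3 dvd x + 3 * y" using assms by (simp_all add: dvd_add_left_iff)
  moreover have "\<bar>x - 3 * y\<bar> = 6 * y - (x + 3 * y)" using False by simp
  moreover have "(p mod 6 = 5) \<noteq> ((6 * y - p) mod 6 = 5)" if "odd p" "\<not> 3 dvd p" for p :: int
    using that by presburger
  ultimately have "((x + 3 * y) mod 6 = 5) \<noteq> (\<bar>x - 3 * y\<bar> mod 6 = 5)" by metis
  then show ?thesis using False by simp
qed

lemma card_pos_reps_filter:
  "card {(x, y) \<in> pos_reps S. Pr x y} = (\<Sum>(x, y)\<in>pos_reps S. if Pr x y then 1 else 0)"
  using card_filter_eq_sum[OF finite_pos_reps, of S "\<lambda>(x, y). Pr x y"]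
  by (simp add: case_prod_unfold)

lemma three_dvd_square: "3 dvd x" if "3 dvd x * x" for x :: int
proof -
  have "prime (3 :: int)" by simp
  then show ?thesis using that by (metis prime_dvd_mult_iff)
qed

text \<open>If 3 does not divide S, the sign lemmas make each member of \<open>pos_reps\<close>
  contribute oddly to the counts u = 3 mod 4 and u = 5 mod 6 together, which cancels its own count.
  If S = 3 S', no u is 5 mod 6, the representations with x < 3 y are the short ones of S', and these
  cancel against those of \<open>even_card_wide_triples\<close>. Two terms for S' = y^2 remain, and
  exactly one of them is 1.\<close>

theorem odd_card_lambert_triples:
  assumes S: "S > 0" "S mod 4 = 3"
  shows "odd (card (lambert_triples S)) \<longleftrightarrow> thrice_square S"
proof -
  define g1 g2 :: "int \<Rightarrow> bool" where "g1 u \<longleftrightarrow> u mod 4 = 3" and "g2 u \<longleftrightarrow> u mod 6 = 5" for u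
  \<comment> \<open>By \<open>card_odd_reps\<close> a representation (x, y) of S yields the values u
    = x + 3 y and u = |x - 3 y|; \<open>m\<close> counts those that pass the filter.\<close>
  define m :: "(int \<Rightarrow> bool) \<Rightarrow> int \<times> int \<Rightarrow> nat" where
    "m g = (\<lambda>(x, y). (if g (x + 3 * y) then 1 else 0) + (if g \<bar>x - 3 * y\<bar> then 1 else 0))" for g
  have card_g: "card {(u, d) \<in> odd_reps S. g u} =
      (if \<exists>y>0. 3 * (y * y) = S \<and> g (3 * y) then 1 else 0) + (\<Sum>t\<in>pos_reps S. m g t)" for g
    unfolding card_odd_reps[OF S(2)] card_thrice_square[of S "\<lambda>y. g (3 * y)"] card_pos_reps_filter
    by (simp add: m_def sum.distrib[symmetric] case_prod_unfold)
  have parity: "even x" "odd y" if "(x, y) \<in> pos_reps S" for x y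
    using that reps_parity[OF _ S(2)] by (auto simp: pos_reps_def)
  have "card (ordered_triples S) = card {t \<in> ordered_triples S. 3 dvd fst t} + card {t \<in> ordered_triples S. \<not> 3 dvd fst t}"
    by (rule card_split[OF finite_ordered_triples])
  then have lambert_triples: "even (card (lambert_triples S)) \<longleftrightarrow> even (card (pos_reps S) + card {(u, d) \<in> odd_reps S. g1 u} +
      card {(u, d) \<in> odd_reps S. g2 u} + card {t \<in> ordered_triples S. 3 dvd fst t})"
    using even_card_ordered_triples[OF S(2)] by (auto simp: card_lambert_triples g1_def g2_def)
  show ?thesis
  proof (cases "3 dvd S")
    case False
    have no_sq: "3 * (y * y) \<noteq> S" for y using False by auto
    have "card {t \<in> ordered_triples S. 3 dvd fst t} = 0"
    proof (rule card_eq_0_iff[THEN iffD2], rule disjI1, rule equals0I)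
      fix t assume t: "t \<in> {t \<in> ordered_triples S. 3 dvd fst t}"
      obtain a b c where abc: "t = (a, b, c)" by (cases t)
      have "3 dvd a" "a * b + 3 * (c * c) = 4 * S" using t by (simp_all add: abc ordered_triples_def)
      then have "3 dvd 4 * S" by (metis dvd_add dvd_mult2 dvd_triv_left)
      then have "3 dvd S" by presburger
      then show False using False by simp
    qed
    moreover have "even ((\<Sum>t\<in>pos_reps S. m g1 t) + (\<Sum>t\<in>pos_reps S. m g2 t)) \<longleftrightarrow> even (card (pos_reps S))"
    proof -
      have "even (\<Sum>t\<in>pos_reps S. m g1 t + m g2 t) \<longleftrightarrow> even (\<Sum>t\<in>pos_reps S. 1 :: nat)"
      proof (rule even_sum_cong)
        fix t assume t: "t \<in> pos_reps S"
        obtain x y where xy: "t = (x, y)" by (cases t)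
        have "\<not> 3 dvd x"
        proof
          assume "3 dvd x"
          moreover have "x * x + 3 * (y * y) = S" using t by (simp add: xy pos_reps_def)
          ultimately have "3 dvd S" by (metis dvd_add dvd_mult2 dvd_triv_left)
          then show False using False by simp
        qed
        then show "even (m g1 t + m g2 t) \<longleftrightarrow> even (1 :: nat)"
          using mod_4_sign_parity[of x y] mod_6_sign_parity[of x y] parity[of x y] t
          by (auto simp: xy m_def g1_def g2_def split: if_splits)
      qed
      then show ?thesis by (simp add: sum.distrib)
    qed
    ultimately have "even (card (lambert_triples S))"
      unfolding lambert_triples card_g by (auto simp: no_sq)
    moreover have "\<not> thrice_square S" using no_sq by (simp add: thrice_square_def)
    ultimately show ?thesis by simp
  next
    case True
    then obtain S' where S': "S = 3 * S'" by (rule dvdE)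
    have "S' mod 4 = 1" "S' > 0" using S unfolding S' by presburger+
    have three_dvd: "3 dvd x" if "x * x + 3 * y = 3 * z" for x y z :: int
    proof -
      have "x * x = 3 * (z - y)" using that by simp
      then show ?thesis using three_dvd_square[of x] by simp
    qed
    have "card {(u, d) \<in> odd_reps S. g2 u} = 0"
    proof (rule card_eq_0_iff[THEN iffD2], rule disjI1, rule equals0I)
      fix t assume t: "t \<in> {(u, d) \<in> odd_reps S. g2 u}"
      obtain u d where ud: "t = (u, d)" by (cases t)
      have u: "u mod 6 = 5" "u * u + 3 * (d * d) = 3 * (4 * S')"
        using t by (simp_all add: ud odd_reps_def g2_def S')
      have "3 dvd u" by (rule three_dvd[OF u(2)])
      then show False using u(1) by presburger
    qed
    moreover have "even (card (pos_reps S) + (\<Sum>t\<in>pos_reps S. m g1 t)) \<longleftrightarrow> even (card (short_reps S'))"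
    proof -
      have "even (\<Sum>t\<in>pos_reps S. m g1 t) \<longleftrightarrow> even (\<Sum>t\<in>pos_reps S. if fst t > 3 * snd t then 1 else 0 :: nat)"
      proof (rule even_sum_cong)
        fix t assume t: "t \<in> pos_reps S"
        obtain x y where xy: "t = (x, y)" by (cases t)
        show "even (m g1 t) \<longleftrightarrow> even (if fst t > 3 * snd t then 1 else 0 :: nat)"
          using mod_4_sign_parity[of x y] parity[of x y] t
          by (auto simp: xy m_def g1_def split: if_splits)
      qed
      also have "(\<Sum>t\<in>pos_reps S. if fst t > 3 * snd t then 1 else 0 :: nat) =
          card {t \<in> pos_reps S. fst t > 3 * snd t}"
        by (rule card_filter_eq_sum[OF finite_pos_reps, symmetric])
      finally have "even (card (pos_reps S) + (\<Sum>t\<in>pos_reps S. m g1 t)) \<longleftrightarrow>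
          even (card {t \<in> pos_reps S. \<not> fst t > 3 * snd t})"
        unfolding card_split[OF finite_pos_reps, of S "\<lambda>t. fst t > 3 * snd t"] by auto
      also have "card {t \<in> pos_reps S. \<not> fst t > 3 * snd t} = card (short_reps S')"
      proof (rule bij_betw_card_witness[where f = "\<lambda>(x, y). (y, x div 3)" and g = "\<lambda>(x, y). (3 * y, x)"])
        fix t assume t: "t \<in> {t \<in> pos_reps S. \<not> fst t > 3 * snd t}"
        obtain x y where xy: "t = (x, y)" by (cases t)
        have *: "x * x + 3 * (y * y) = 3 * S'" "x > 0" "y > 0" "x \<le> 3 * y"
          using t by (simp_all add: xy pos_reps_def S')
        obtain z where x: "x = 3 * z" using three_dvd[OF *(1)] by (rule dvdE)
        have "x \<noteq> 3 * y" using parity[of x y] t by (auto simp: xy)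
        moreover have "y * y + 3 * (z * z) = S'" using *(1) unfolding x by simp
        ultimately show "(\<lambda>(x, y). (y, x div 3)) t \<in> short_reps S' \<and>
            (\<lambda>(x, y). (3 * y, x)) ((\<lambda>(x, y). (y, x div 3)) t) = t"
          using *(2-4) by (simp add: xy x short_reps_def)
      next
        fix t assume t: "t \<in> short_reps S'"
        obtain x y where xy: "t = (x, y)" by (cases t)
        show "(\<lambda>(x, y). (3 * y, x)) t \<in> {t \<in> pos_reps S. \<not> fst t > 3 * snd t} \<and>
            (\<lambda>(x, y). (y, x div 3)) ((\<lambda>(x, y). (3 * y, x)) t) = t"
          using t by (simp add: xy short_reps_def pos_reps_def S')
      qed
      finally show ?thesis .
    qed
    moreover have "card {t \<in> ordered_triples S. 3 dvd fst t} = card (wide_triples S')"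
    proof (rule bij_betw_card_witness[where f = "\<lambda>(a, b, c). (a div 3, b, c)" and g = "\<lambda>(a, b, c). (3 * a, b, c)"])
      fix t assume t: "t \<in> {t \<in> ordered_triples S. 3 dvd fst t}"
      obtain a b c where abc: "t = (a, b, c)" by (cases t)
      have *: "a * b + 3 * (c * c) = 4 * S" "3 dvd a" "a > 0" "c > 0" "odd c" "a < b"
        using t by (simp_all add: abc ordered_triples_def)
      obtain k where a: "a = 3 * k" using *(2) by (rule dvdE)
      have "odd k" using odd_of_eq[OF *(1,5)] unfolding a by simp
      moreover have "k * b + c * c = 4 * S'" using *(1) unfolding a S' by simp
      ultimately show "(\<lambda>(a, b, c). (a div 3, b, c)) t \<in> wide_triples S' \<and>
          (\<lambda>(a, b, c). (3 * a, b, c)) ((\<lambda>(a, b, c). (a div 3, b, c)) t) = t"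
        using *(3-6) by (simp add: abc a wide_triples_def)
    next
      fix t assume t: "t \<in> wide_triples S'"
      obtain a b c where abc: "t = (a, b, c)" by (cases t)
      show "(\<lambda>(a, b, c). (3 * a, b, c)) t \<in> {t \<in> ordered_triples S. 3 dvd fst t} \<and>
          (\<lambda>(a, b, c). (a div 3, b, c)) ((\<lambda>(a, b, c). (3 * a, b, c)) t) = t"
        using t by (simp add: abc wide_triples_def ordered_triples_def S')
    qed
    \<comment> \<open>For S' = y^2 with y odd, the left term asks for 3 y = 3 mod 4, hence y = 1 mod
      4, and the root term for y = 3 mod 4.\<close>
    moreover have "(\<exists>y>0. 3 * (y * y) = S \<and> g1 (3 * y)) \<noteq> root_3_mod_4 S' \<longleftrightarrow> thrice_square S"
    proof (cases "\<exists>y>0. y * y = S'")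
      case True
      then obtain y where y: "y > 0" "y * y = S'" by blast
      have "odd y" using square_mod_4[of y] \<open>S' mod 4 = 1\<close> y(2) by (cases "even y") simp_all
      have "(\<exists>y>0. 3 * (y * y) = S \<and> g1 (3 * y)) \<longleftrightarrow> g1 (3 * y)"
      proof
        assume "\<exists>y>0. 3 * (y * y) = S \<and> g1 (3 * y)"
        then obtain z where z: "z > 0" "3 * (z * z) = S" "g1 (3 * z)" by blast
        then have "z * z = y * y" using y(2) by (simp add: S')
        then have "z = y" using z(1) y(1) by (rule square_inj_pos)
        then show "g1 (3 * y)" using z(3) by simp
      qed (use y in \<open>auto simp: S'\<close>)
      moreover have "root_3_mod_4 S' \<longleftrightarrow> y mod 4 = 3" using root_3_mod_4_iff[OF y(1)] y(2) by simp
      moreover have "g1 (3 * y) \<longleftrightarrow> y mod 4 = 1" unfolding g1_def by presburger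
      moreover have "y mod 4 = 1 \<longleftrightarrow> y mod 4 \<noteq> 3" using \<open>odd y\<close> by presburger
      moreover have "thrice_square S" using y by (auto simp: thrice_square_def S')
      ultimately show ?thesis by simp
    next
      case False
      then have "\<not> root_3_mod_4 S'" "\<not> thrice_square S" "\<not> (\<exists>y>0. 3 * (y * y) = S \<and> g1 (3 * y))"
        by (auto simp: root_3_mod_4_def thrice_square_def S')
      then show ?thesis by simp
    qed
    ultimately show ?thesis
      using lambert_triples even_card_wide_triples[OF \<open>S' > 0\<close> \<open>S' mod 4 = 1\<close>]
      unfolding card_g[of g1] by (auto split: if_splits)
  qed
qed


section \<open>Power series modulo 2\<close>

text \<open>Congruence modulo the ideal generated by 2 and X^M: the term \<open>2 * u\<close>
  absorbs signs and cross terms of squares, the other one the truncation.\<close>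

definition cong2 :: "nat \<Rightarrow> int fps \<Rightarrow> int fps \<Rightarrow> bool" where
  "cong2 M f g \<longleftrightarrow> (\<exists>u w. f - g = 2 * u + fps_X ^ M * w)"

lemma cong2_refl: "cong2 M f f"
  unfolding cong2_def by (intro exI[of _ 0]) simp

lemma cong2_sym: "cong2 M f g \<Longrightarrow> cong2 M g f"
proof -
  assume "cong2 M f g"
  then obtain u w where "f - g = 2 * u + fps_X ^ M * w" unfolding cong2_def by blast
  then have "g - f = 2 * (- u) + fps_X ^ M * (- w)" by (simp add: algebra_simps)
  then show ?thesis unfolding cong2_def by blast
qed

lemma cong2_add:
  assumes "cong2 M f g" "cong2 M f' g'"
  shows "cong2 M (f + f') (g + g')"
proof -
  obtain u w u' w' where "f - g = 2 * u + fps_X ^ M * w" "f' - g' = 2 * u' + fps_X ^ M * w'"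
    using assms unfolding cong2_def by blast
  then have "(f + f') - (g + g') = 2 * (u + u') + fps_X ^ M * (w + w')" by (simp add: algebra_simps)
  then show ?thesis unfolding cong2_def by blast
qed

lemma cong2_mult:
  assumes "cong2 M f g" "cong2 M f' g'"
  shows "cong2 M (f * f') (g * g')"
proof -
  obtain u w u' w' where *: "f - g = 2 * u + fps_X ^ M * w" "f' - g' = 2 * u' + fps_X ^ M * w'"
    using assms unfolding cong2_def by blast
  have "f * f' - g * g' = (f - g) * f' + g * (f' - g')" by (simp add: algebra_simps)
  also have "\<dots> = 2 * (u * f' + g * u') + fps_X ^ M * (w * f' + g * w')"
    unfolding * by (simp add: algebra_simps)
  finally show ?thesis unfolding cong2_def by blast
qed

lemma cong2_power: "cong2 M f g \<Longrightarrow> cong2 M (f ^ k) (g ^ k)"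
  by (induction k) (auto intro: cong2_refl cong2_mult)

lemma cong2_trans [trans]:
  assumes "cong2 M f g" "cong2 M g h"
  shows "cong2 M f h"
proof -
  obtain u w u' w' where "f - g = 2 * u + fps_X ^ M * w" "g - h = 2 * u' + fps_X ^ M * w'"
    using assms unfolding cong2_def by blast
  then have "f - h = 2 * (u + u') + fps_X ^ M * (w + w')" by (simp add: algebra_simps)
  then show ?thesis unfolding cong2_def by blast
qed

lemma cong2_sum: "(\<And>x. x \<in> A \<Longrightarrow> cong2 M (f x) (g x)) \<Longrightarrow> cong2 M (sum f A) (sum g A)"
  by (induction A rule: infinite_finite_induct) (auto intro: cong2_refl cong2_add)

lemma cong2_prod: "(\<And>x. x \<in> A \<Longrightarrow> cong2 M (f x) (g x)) \<Longrightarrow> cong2 M (prod f A) (prod g A)"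
  by (induction A rule: infinite_finite_induct) (auto intro: cong2_refl cong2_mult)

lemma cong2_dvd: "fps_X ^ M dvd f - g \<Longrightarrow> cong2 M f g"
  unfolding cong2_def by (metis add_0 dvdE mult_zero_right)

lemma cong2_even: "f - g = 2 * u \<Longrightarrow> cong2 M f g"
  unfolding cong2_def by (metis add_0_right mult_zero_right)

lemma cong2_nth:
  assumes "cong2 M f g" "i < M"
  shows "even (fps_nth f i) \<longleftrightarrow> even (fps_nth g i)"
proof -
  obtain u w where "f - g = 2 * u + fps_X ^ M * w" using assms(1) unfolding cong2_def by blast
  then have "fps_nth (f - g) i = fps_nth (u + u + fps_X ^ M * w) i" by (simp only: mult_2)
  then have "fps_nth f i - fps_nth g i = fps_nth u i + fps_nth u i"
    by (simp only: fps_sub_nth fps_add_nth fps_X_power_mult_nth assms(2) if_True add_0_right)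
  then have "even (fps_nth f i - fps_nth g i)" by simp
  then show ?thesis by simp
qed

lemma cong2_square_sum:
  fixes f :: "'a \<Rightarrow> int fps"
  shows "cong2 M ((sum f A)\<^sup>2) (\<Sum>x\<in>A. (f x)\<^sup>2)"
proof (induction A rule: infinite_finite_induct)
  case (insert x F)
  have "cong2 M ((f x + sum f F)\<^sup>2) ((f x)\<^sup>2 + (sum f F)\<^sup>2)"
    by (rule cong2_even[of _ _ "f x * sum f F"]) (simp add: power2_eq_square algebra_simps)
  also have "cong2 M ((f x)\<^sup>2 + (sum f F)\<^sup>2) ((f x)\<^sup>2 + (\<Sum>x\<in>F. (f x)\<^sup>2))"
    by (rule cong2_add[OF cong2_refl insert.IH])
  finally show ?case using insert by simp
qed (simp_all add: cong2_refl)

section \<open>Euler products and geometric series\<close>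

definition euler_prod :: "nat \<Rightarrow> nat \<Rightarrow> int fps" where
  "euler_prod N k = (\<Prod>i<N. 1 - fps_X ^ (k * Suc i))"

lemma cong2_euler_prod_square: "cong2 M ((euler_prod N k)\<^sup>2) (euler_prod N (2 * k))"
proof -
  have "(euler_prod N k)\<^sup>2 = (\<Prod>i<N. (1 - fps_X ^ (k * Suc i))\<^sup>2)"
    by (simp add: euler_prod_def prod_power_distrib)
  also have "cong2 M \<dots> (euler_prod N (2 * k))"
    unfolding euler_prod_def
  proof (rule cong2_prod)
    fix i
    have "fps_X ^ (2 * k * Suc i) = (fps_X ^ (k * Suc i) * fps_X ^ (k * Suc i) :: int fps)"
      by (simp only: power_add[symmetric] mult_2 distrib_right)
    then show "cong2 M ((1 - fps_X ^ (k * Suc i))\<^sup>2) (1 - fps_X ^ (2 * k * Suc i))"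
      by (intro cong2_even[of _ _ "fps_X ^ (k * Suc i) * fps_X ^ (k * Suc i) - fps_X ^ (k * Suc i)"])
        (simp add: power2_eq_square algebra_simps)
  qed
  finally show ?thesis .
qed

lemma euler_prod_nth_0: "k > 0 \<Longrightarrow> fps_nth (euler_prod N k) 0 = 1"
  by (induction N) (simp_all add: euler_prod_def)

lemma euler_prod_nth: "\<not> k dvd i \<Longrightarrow> fps_nth (euler_prod N k) i = 0"
proof (induction N arbitrary: i)
  case 0
  then show ?case by (cases "i = 0") (simp_all add: euler_prod_def)
next
  case (Suc N)
  have "fps_nth (euler_prod (Suc N) k) i =
      fps_nth (euler_prod N k) i - fps_nth (fps_X ^ (k * Suc N) * euler_prod N k) i"
    by (simp add: euler_prod_def algebra_simps del: mult_Suc_right)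
  moreover have "\<not> k dvd i - k * Suc N" if "\<not> i < k * Suc N"
    using that Suc.prems dvd_diffD[of k i "k * Suc N"] by (auto simp del: mult_Suc_right)
  ultimately show ?case
    using Suc by (simp add: fps_X_power_mult_nth del: mult_Suc_right)
qed

definition geom :: "nat \<Rightarrow> int fps" where
  "geom a = Abs_fps (\<lambda>m. of_bool (a dvd m))"

lemma geom_inverse:
  assumes "a > 0"
  shows "(1 - fps_X ^ a) * geom a = 1"
proof (rule fps_ext)
  fix m
  have "fps_nth ((1 - fps_X ^ a) * geom a) m = fps_nth (geom a) m - fps_nth (fps_X ^ a * geom a) m"
    by (simp add: left_diff_distrib)
  also have "\<dots> = of_bool (m = 0)"
    using assms by (cases "m < a") (auto simp: geom_def fps_X_power_mult_nth dvd_minus_self dest: nat_dvd_not_less)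
  finally show "fps_nth ((1 - fps_X ^ a) * geom a) m = fps_nth 1 m" by simp
qed

lemma mult_inverse_unique:
  assumes "d * x = 1" "d * y = (1 :: 'a::comm_ring_1)"
  shows "x = y"
proof -
  have "x = x * (d * y)" using assms(2) by simp
  also have "\<dots> = (d * x) * y" by (simp only: mult_ac)
  finally show ?thesis using assms(1) by simp
qed

section \<open>Specialisation of the q-series identities to xi\<close>

definition xi_factor_inv :: "nat \<Rightarrow> int fps" where
  "xi_factor_inv r = geom (6 * r + 1) * geom (6 * r + 5)"

lemma xi_factor_inv:
  "(1 + (fps_X ^ 6) ^ (2 * r + 1) - (fps_X + fps_X ^ 5) * (fps_X ^ 6) ^ r) * xi_factor_inv r = 1"
proof -
  have "1 + (fps_X ^ 6) ^ (2 * r + 1) - (fps_X + fps_X ^ 5) * (fps_X ^ 6) ^ r =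
      (1 - fps_X ^ (6 * r + 1)) * (1 - fps_X ^ (6 * r + 5) :: int fps)"
  proof -
    have "(fps_X ^ 6) ^ (2 * r + 1) = (fps_X ^ (6 * r + 1) * fps_X ^ (6 * r + 5) :: int fps)"
      "fps_X * (fps_X ^ 6) ^ r = (fps_X ^ (6 * r + 1) :: int fps)"
      "fps_X ^ 5 * (fps_X ^ 6) ^ r = (fps_X ^ (6 * r + 5) :: int fps)"
      by (simp_all flip: power_mult power_add power_Suc add: algebra_simps)
    then show ?thesis by (simp only: distrib_right) (simp add: algebra_simps)
  qed
  moreover have "(1 - fps_X ^ (6 * r + 1)) * (1 - fps_X ^ (6 * r + 5)) * xi_factor_inv r =
      ((1 - fps_X ^ (6 * r + 1)) * geom (6 * r + 1)) * ((1 - fps_X ^ (6 * r + 5)) * geom (6 * r + 5))"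
    by (simp only: xi_factor_inv_def mult_ac)
  moreover have "(1 - fps_X ^ (6 * r + 1)) * geom (6 * r + 1) = 1" "(1 - fps_X ^ (6 * r + 5)) * geom (6 * r + 5) = 1"
    by (rule geom_inverse, simp)+
  ultimately show ?thesis by (simp only: mult_1_left)
qed

text \<open>With x = q^(6r+1) and y = q^(6r+5), 1 - x y = (1 - y) + y (1 - x). The asymmetry of this
  splitting is the origin of the bounds a < b for a = 1 mod 6 and a <= b for a = 5 mod 6.\<close>

lemma xi_factor_partial_fractions:
  "(1 - (fps_X ^ 6) ^ (2 * r + 1)) * xi_factor_inv r =
    geom (6 * r + 1) + fps_X ^ (6 * r + 5) * geom (6 * r + 5)"
proof -
  define x y :: "int fps" where "x = fps_X ^ (6 * r + 1)" and "y = fps_X ^ (6 * r + 5)"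
  define g h where "g = geom (6 * r + 1)" and "h = geom (6 * r + 5)"
  have gh: "(1 - x) * g = 1" "(1 - y) * h = 1"
    using geom_inverse[of "6 * r + 1"] geom_inverse[of "6 * r + 5"] by (simp_all add: x_def y_def g_def h_def)
  have "6 * (2 * r + 1) = 6 * r + 1 + (6 * r + 5)" by simp
  then have "(fps_X ^ 6) ^ (2 * r + 1) = x * y"
    unfolding x_def y_def by (simp only: power_mult[symmetric] power_add[symmetric])
  then have "(1 - (fps_X ^ 6) ^ (2 * r + 1)) * xi_factor_inv r = (1 - x * y) * (g * h)"
    by (simp only: xi_factor_inv_def g_def h_def)
  also have "\<dots> = ((1 - y) * h) * g + y * ((1 - x) * g) * h"
    by (simp add: algebra_simps)
  finally show ?thesis unfolding gh by (simp add: g_def h_def y_def)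
qed

lemma right_inverse_xi_denom:
  "fps_right_inverse (xi_denom (Suc n)) 1 = (\<Prod>r\<le>n. xi_factor_inv r)"
proof (rule mult_inverse_unique)
  show "xi_denom (Suc n) * fps_right_inverse (xi_denom (Suc n)) 1 = 1"
    by (rule xi_denom_right_inverse)
  have "xi_denom (Suc n) * (\<Prod>r\<le>n. xi_factor_inv r) =
      (\<Prod>r\<le>n. (1 - fps_X * (fps_X ^ 6) ^ r) * (1 - fps_X ^ 5 * (fps_X ^ 6) ^ r) * xi_factor_inv r)"
    by (simp add: xi_denom_def qpochhammer_def prod.distrib lessThan_Suc_atMost)
  also have "\<dots> = (\<Prod>r\<le>n. 1)"
  proof (rule prod.cong[OF refl])
    fix r :: nat
    have "(1 - fps_X * (fps_X ^ 6) ^ r) * (1 - fps_X ^ 5 * (fps_X ^ 6) ^ r) =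
        (1 + (fps_X ^ 6) ^ (2 * r + 1) - (fps_X + fps_X ^ 5) * (fps_X ^ 6) ^ r :: int fps)"
    proof -
      have "(1 - x * q) * (1 - y * q) = 1 + q * q * (x * y) - (x + y) * q" for x y q :: "int fps"
        by (simp add: algebra_simps)
      moreover have "(fps_X ^ 6) ^ (2 * r + 1) = (fps_X ^ 6) ^ r * (fps_X ^ 6) ^ r * (fps_X * fps_X ^ 5 :: int fps)"
        unfolding mult_2 power_add power_one_right power_Suc[symmetric] by simp
      ultimately show ?thesis by (simp only:)
    qed
    then show "(1 - fps_X * (fps_X ^ 6) ^ r) * (1 - fps_X ^ 5 * (fps_X ^ 6) ^ r) * xi_factor_inv r = 1"
      by (simp only: xi_factor_inv)
  qed
  finally show "xi_denom (Suc n) * (\<Prod>r\<le>n. xi_factor_inv r) = 1" by simp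
qed

definition xi_partial :: "nat \<Rightarrow> int fps" where
  "xi_partial N = (\<Sum>n\<le>N. (fps_X ^ 6) ^ (n * (n + 1)) * (\<Prod>r\<le>n. xi_factor_inv r))"

lemma xi_summand_Suc:
  "xi_summand (Suc n) = fps_X * ((fps_X ^ 6) ^ (n * (n + 1)) * (\<Prod>r\<le>n. xi_factor_inv r))"
proof -
  have "6 * (Suc n)\<^sup>2 - 6 * Suc n + 1 = Suc (6 * (n * (n + 1)))"
    by (simp add: power2_eq_square algebra_simps)
  then show ?thesis
    unfolding xi_summand_def right_inverse_xi_denom by (simp only: power_Suc power_mult mult.assoc)
qed

text \<open>Summands with index above m do not reach the coefficient of q^m, so the truncation level
  can be tied to the exponent.\<close>

lemma p_xi_eq:
  assumes "m > 0"
  shows "p_xi m = 2 * fps_nth (fps_X * xi_partial m) m"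
proof -
  define f where "f = (\<Sum>n. xi_summand (Suc n))"
  have f: "fps_nth f m = (\<Sum>n<m. fps_nth (xi_summand (Suc n)) m)"
    unfolding f_def sums_unique[OF xi_summand_sums, symmetric] by simp
  have "p_xi m = fps_nth (1 + (f + f)) m"
    by (simp only: p_xi_def xi_def mult_2 f_def)
  also have "\<dots> = 2 * fps_nth f m"
    by (simp only: fps_add_nth) (use assms in simp)
  also have "fps_nth f m = (\<Sum>n\<le>m. fps_nth (xi_summand (Suc n)) m)"
    unfolding f by (intro sum.mono_neutral_left) (auto simp: xi_summand_nth_eq_0)
  also have "\<dots> = fps_nth (fps_X * xi_partial m) m"
    by (simp only: xi_partial_def sum_distrib_left xi_summand_Suc fps_sum_nth)
  finally show ?thesis .
qed

interpretation xi: qseries "fps_X ^ 6 :: int fps" "\<lambda>n. geom (6 * n)"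
proof
  show "(1 - (fps_X ^ 6) ^ n) * geom (6 * n) = 1" if "n > 0" for n
    using geom_inverse[of "6 * n"] that by (simp add: power_mult)
qed

lemma xi_qpoch: "xi.qpoch N = euler_prod N 6"
  by (simp add: xi.qpoch_def euler_prod_def power_mult[symmetric] del: power_Suc)

section \<open>Lambert and theta series modulo 2\<close>

definition lambert :: "nat \<Rightarrow> int fps" where
  "lambert N = (\<Sum>r\<le>N. fps_X ^ (9 * (r * (r + 1)) + 1) *
     (geom (6 * r + 1) + fps_X ^ (6 * r + 5) * geom (6 * r + 5)))"

definition theta :: "nat \<Rightarrow> int fps" where
  "theta N = (\<Sum>s\<le>N. fps_X ^ (3 * (s * (s + 1))))"

lemma two_tri: "2 * (r * (r + 1) div 2) = r * (r + 1)" for r :: nat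
  by simp

lemma power_6_tri: "(fps_X ^ 6) ^ (r * (r + 1) div 2) = (fps_X ^ (3 * (r * (r + 1))) :: int fps)"
proof -
  have "6 * (r * (r + 1) div 2) = 3 * (r * (r + 1))" using two_tri[of r] by linarith
  then show ?thesis by (simp only: power_mult[symmetric])
qed

lemma cong2_minus_one_power: "cong2 M ((-1) ^ r * f) f"
proof (cases "even r")
  case False
  then show ?thesis by (intro cong2_even[of _ _ "- f"]) simp
qed (simp add: cong2_refl)

text \<open>The signs of \<open>xi.bailey_limit\<close> disappear modulo 2, and its factor 1 -
  Q^(2r+1) is the numerator that \<open>xi_factor_partial_fractions\<close> splits. The exponent 9 r
  (r + 1) + 1 is six times 3 r (r + 1) / 2, plus 1 for the leading q.\<close>

lemma cong2_xi_partial: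
  "cong2 (6 * Suc N) (euler_prod N 6 * (fps_X * xi_partial N)) (lambert N)"
proof -
  have "cong2 (6 * Suc N) (euler_prod N 6 * xi_partial N) (\<Sum>r\<le>N. (-1) ^ r *
      ((fps_X ^ 6) ^ (3 * (r * (r + 1) div 2)) * (1 - (fps_X ^ 6) ^ (2 * r + 1)) * xi_factor_inv r))"
    using xi.bailey_limit[OF xi_factor_inv, of N]
    unfolding xi_qpoch xi_partial_def by (intro cong2_dvd) (simp only: power_mult mult.assoc)
  also have "cong2 (6 * Suc N) \<dots> (\<Sum>r\<le>N.
      (fps_X ^ 6) ^ (3 * (r * (r + 1) div 2)) * (1 - (fps_X ^ 6) ^ (2 * r + 1)) * xi_factor_inv r)"
    by (intro cong2_sum cong2_minus_one_power)
  finally have "cong2 (6 * Suc N) (fps_X * (euler_prod N 6 * xi_partial N)) (fps_X * (\<Sum>r\<le>N.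
      (fps_X ^ 6) ^ (3 * (r * (r + 1) div 2)) * (1 - (fps_X ^ 6) ^ (2 * r + 1)) * xi_factor_inv r))"
    by (intro cong2_mult cong2_refl)
  also have "fps_X * (\<Sum>r\<le>N. (fps_X ^ 6) ^ (3 * (r * (r + 1) div 2)) *
      (1 - (fps_X ^ 6) ^ (2 * r + 1)) * xi_factor_inv r) = lambert N"
    unfolding lambert_def sum_distrib_left
  proof (rule sum.cong[OF refl])
    fix r :: nat
    have "6 * (3 * (r * (r + 1) div 2)) = 9 * (r * (r + 1))" using two_tri[of r] by linarith
    then have "fps_X * (fps_X ^ 6) ^ (3 * (r * (r + 1) div 2)) = (fps_X ^ (9 * (r * (r + 1)) + 1) :: int fps)"
      by (simp only: power_mult[symmetric] power_Suc[symmetric] Suc_eq_plus1)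
    then show "fps_X * ((fps_X ^ 6) ^ (3 * (r * (r + 1) div 2)) * (1 - (fps_X ^ 6) ^ (2 * r + 1)) * xi_factor_inv r) =
        fps_X ^ (9 * (r * (r + 1)) + 1) * (geom (6 * r + 1) + fps_X ^ (6 * r + 5) * geom (6 * r + 5))"
      by (simp only: mult.assoc xi_factor_partial_fractions) (simp only: mult.assoc[symmetric])
  qed
  finally show ?thesis by (simp only: mult.left_commute)
qed

lemma cong2_theta: "cong2 (6 * Suc N) (euler_prod N 6 ^ 3) (theta N)"
proof -
  have "cong2 (6 * Suc N) (euler_prod N 6 ^ 3)
      (\<Sum>r\<le>N. (-1) ^ r * (of_nat (2 * r + 1) * (fps_X ^ 6) ^ (r * (r + 1) div 2)))"
    using xi.jacobi_cube_limit[of N]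
    unfolding xi_qpoch by (intro cong2_dvd) (simp only: power_mult mult.assoc)
  also have "cong2 (6 * Suc N) \<dots> (theta N)"
    unfolding theta_def
  proof (rule cong2_sum)
    fix r :: nat
    have "cong2 (6 * Suc N) (of_nat (2 * r + 1) * (fps_X ^ 6) ^ (r * (r + 1) div 2)) ((fps_X ^ 6) ^ (r * (r + 1) div 2))"
      by (rule cong2_even[of _ _ "of_nat r * (fps_X ^ 6) ^ (r * (r + 1) div 2)"]) (simp add: algebra_simps)
    then show "cong2 (6 * Suc N) ((-1) ^ r * (of_nat (2 * r + 1) * (fps_X ^ 6) ^ (r * (r + 1) div 2)))
        (fps_X ^ (3 * (r * (r + 1))))"
      unfolding power_6_tri by (rule cong2_trans[OF cong2_minus_one_power])
  qed
  finally show ?thesis .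
qed

text \<open>With \<open>a = 6 r + \<rho>\<close> and \<open>c = 2 s + 1\<close>, every exponent \<open>i\<close> satisfies
  \<open>4 (i + 1) = a b + 3 c\<^sup>2\<close> with \<open>b - a\<close> a multiple of 4; \<open>\<delta>\<close> records whether \<open>b = a\<close> is excluded.\<close>

lemma card_lambert_exponents:
  fixes \<rho> \<delta> i N :: nat and e :: "nat \<Rightarrow> nat \<Rightarrow> nat"
  assumes \<rho>: "0 < \<rho>" "\<rho> < 6" and \<delta>: "\<delta> \<le> 1" and i: "i \<le> N"
    and e_ge: "\<And>r s. r \<le> e r s \<and> s \<le> e r s"
    and e: "\<And>r s k. int (6 * r + \<rho>) * (int (6 * r + \<rho>) + 4 * (int k + int \<delta>)) +
      3 * ((2 * int s + 1) * (2 * int s + 1)) = 4 * (int (e r s + k * (6 * r + \<rho>)) + 1)"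
  shows "card {(r, s) \<in> {..N} \<times> {..N}. e r s \<le> i \<and> (6 * r + \<rho>) dvd (i - e r s)} =
    card {(a, b, c). a * b + 3 * (c * c) = 4 * (int i + 1) \<and> a > 0 \<and> c > 0 \<and> odd c \<and>
      a mod 6 = int \<rho> \<and> a + int \<delta> \<le> b}" (is "card ?A = card ?B")
proof (rule bij_betw_card_witness)
  fix t assume t: "t \<in> ?A"
  obtain r s where rs: "t = (r, s)" by (cases t)
  have *: "e r s \<le> i" "(6 * r + \<rho>) dvd (i - e r s)" using t by (simp_all add: rs)
  obtain k where "i - e r s = (6 * r + \<rho>) * k" using *(2) by (rule dvdE)
  then have ik: "i = e r s + k * (6 * r + \<rho>)" using *(1) by (simp add: mult.commute)
  define f where "f = (\<lambda>(r, s). (int (6 * r + \<rho>),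
    int (6 * r + \<rho>) + 4 * (int ((i - e r s) div (6 * r + \<rho>)) + int \<delta>), 2 * int s + 1))"
  have "(i - e r s) div (6 * r + \<rho>) = k" unfolding ik using \<rho>(1) by simp
  then have ft: "f t = (int (6 * r + \<rho>), int (6 * r + \<rho>) + 4 * (int k + int \<delta>), 2 * int s + 1)"
    by (simp add: f_def rs)
  have "int (6 * r + \<rho>) mod 6 = int \<rho>" using \<rho>(2) by simp
  moreover have "int (6 * r + \<rho>) > 0" using \<rho>(1) by simp
  ultimately have "f t \<in> ?B" unfolding ft using e[of r k s] ik by simp
  moreover have "(\<lambda>(a, b, c). (nat (a div 6), nat (c div 2))) (f t) = (r, s)"
  proof -
    have "int (6 * r + \<rho>) div 6 = int r" "(2 * int s + 1) div 2 = int s" using \<rho>(2) by presburger+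
    then show ?thesis unfolding ft by (simp only: prod.case nat_int)
  qed
  ultimately show "(\<lambda>(r, s). (int (6 * r + \<rho>),
    int (6 * r + \<rho>) + 4 * (int ((i - e r s) div (6 * r + \<rho>)) + int \<delta>), 2 * int s + 1)) t \<in> ?B \<and>
    (\<lambda>(a, b, c). (nat (a div 6), nat (c div 2))) ((\<lambda>(r, s). (int (6 * r + \<rho>),
    int (6 * r + \<rho>) + 4 * (int ((i - e r s) div (6 * r + \<rho>)) + int \<delta>), 2 * int s + 1)) t) = t"
    unfolding f_def rs by blast
next
  fix t assume t: "t \<in> ?B"
  obtain a b c where abc: "t = (a, b, c)" by (cases t)
  have *: "a * b + 3 * (c * c) = 4 * (int i + 1)" "a > 0" "c > 0" "odd c"
    "a mod 6 = int \<rho>" "a + int \<delta> \<le> b"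
    using t by (simp_all add: abc)
  define r where "r = nat (a div 6)"
  have "int r = a div 6" using *(2) by (simp add: r_def pos_imp_zdiv_nonneg_iff)
  then have a: "a = int (6 * r + \<rho>)" using *(5) mult_div_mod_eq[of 6 a] by simp
  obtain s' where s': "c = 2 * s' + 1" using *(4) by (rule oddE)
  define s where "s = nat s'"
  have c: "c = 2 * int s + 1" using s' *(3) by (simp add: s_def)
  have "c * c mod 4 = 1" using *(4) by (simp add: square_mod_4)
  moreover have "a * b = 4 * (int i + 1) - 3 * (c * c)" using *(1) by simp
  \<comment> \<open>Units mod 4 are their own inverses, so this forces b - a to be a multiple of
    4.\<close>
  ultimately have "a * b mod 4 = 1" by presburger
  then have "a mod 4 = b mod 4" by (rule mult_mod_4_eq_1)
  then have "4 dvd b - a" using mod_eq_dvd_iff[of b 4 a] by simp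
  then obtain j where j: "b - a = 4 * j" by (rule dvdE)
  \<comment> \<open>Here 4 j >= \<delta> and \<delta> <= 1, so j >= \<delta>, and the truncation to
    a natural number below is exact.\<close>
  have "j \<ge> int \<delta>" using *(6) j \<delta> by presburger
  define k where "k = nat (j - int \<delta>)"
  have k: "j = int k + int \<delta>" using \<open>j \<ge> int \<delta>\<close> by (simp add: k_def)
  have b: "b = int (6 * r + \<rho>) + 4 * (int k + int \<delta>)" using j k a by simp
  have "4 * (int (e r s + k * (6 * r + \<rho>)) + 1) = 4 * (int i + 1)"
    using *(1) unfolding b e[symmetric] by (simp only: a c)
  then have "int (e r s + k * (6 * r + \<rho>)) = int i" by simp
  then have ik: "i = e r s + k * (6 * r + \<rho>)" by (simp only: of_nat_eq_iff)
  have d: "(i - e r s) div (6 * r + \<rho>) = k" unfolding ik using \<rho>(1) by simp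
  have "r \<le> N" "s \<le> N" using e_ge[of r s] ik i by linarith+
  moreover have "e r s \<le> i" "(6 * r + \<rho>) dvd (i - e r s)" unfolding ik by simp_all
  moreover have "nat (a div 6) = r" "nat (c div 2) = s" by (simp_all add: r_def c)
  ultimately show "(\<lambda>(a, b, c). (nat (a div 6), nat (c div 2))) t \<in> ?A \<and>
    (\<lambda>(r, s). (int (6 * r + \<rho>),
    int (6 * r + \<rho>) + 4 * (int ((i - e r s) div (6 * r + \<rho>)) + int \<delta>), 2 * int s + 1))
    ((\<lambda>(a, b, c). (nat (a div 6), nat (c div 2))) t) = t"
    using d a b c unfolding abc by (simp only: prod.case) simp
qed

lemma nth_power_geom: "fps_nth (fps_X ^ e * geom a) i = of_bool (e \<le> i \<and> a dvd (i - e))"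
  by (auto simp: fps_X_power_mult_nth geom_def)

lemma sum_of_bool_card: "finite A \<Longrightarrow> (\<Sum>x\<in>A. of_bool (Pr x)) = int (card {x \<in> A. Pr x})"
  by (simp add: of_bool_def sum.If_cases Int_def)

text \<open>Apart from multiples k a of the geometric series, 4 (i + 1) - 3 c^2 equals 36 r (r + 1)
  + 5 = (6 r + 1) (6 r + 5). For a = 6 r + 1 this is a (a + 4), whence \<open>\<delta>\<close> = 1.
  For a = 6 r + 5 it is a (a - 4), and the extra factor q^a raises it to a^2, whence
  \<open>\<delta>\<close> = 0.\<close>

lemma nth_lambert_theta:
  assumes "i \<le> N"
  shows "fps_nth (lambert N * theta N) i = int (card (lambert_triples (int i + 1)))"
proof -
  define e1 e2 where "e1 r s = 9 * (r * (r + 1)) + 1 + 3 * (s * (s + 1))"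
    and "e2 r s = 9 * (r * (r + 1)) + 1 + 3 * (s * (s + 1)) + (6 * r + 5)" for r s :: nat
  have "lambert N * theta N = (\<Sum>r\<le>N. \<Sum>s\<le>N.
      fps_X ^ e1 r s * geom (6 * r + 1) + fps_X ^ e2 r s * geom (6 * r + 5))"
    unfolding lambert_def theta_def sum_product e1_def e2_def
    by (intro sum.cong refl) (simp only: power_add distrib_left distrib_right mult_ac)
  also have "\<dots> = (\<Sum>(r, s)\<in>{..N} \<times> {..N}.
      fps_X ^ e1 r s * geom (6 * r + 1) + fps_X ^ e2 r s * geom (6 * r + 5))"
    by (rule sum.cartesian_product)
  finally have "fps_nth (lambert N * theta N) i =
      (\<Sum>(r, s)\<in>{..N} \<times> {..N}. of_bool (e1 r s \<le> i \<and> (6 * r + 1) dvd (i - e1 r s))) +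
      (\<Sum>(r, s)\<in>{..N} \<times> {..N}. of_bool (e2 r s \<le> i \<and> (6 * r + 5) dvd (i - e2 r s)))"
    by (simp only: fps_sum_nth case_prod_unfold fps_add_nth nth_power_geom sum.distrib)
  also have "\<dots> = int (card {(r, s) \<in> {..N} \<times> {..N}. e1 r s \<le> i \<and> (6 * r + 1) dvd (i - e1 r s)}) +
      int (card {(r, s) \<in> {..N} \<times> {..N}. e2 r s \<le> i \<and> (6 * r + 5) dvd (i - e2 r s)})"
    using sum_of_bool_card[of "{..N} \<times> {..N}" "\<lambda>(r, s). e1 r s \<le> i \<and> (6 * r + 1) dvd (i - e1 r s)"]
      sum_of_bool_card[of "{..N} \<times> {..N}" "\<lambda>(r, s). e2 r s \<le> i \<and> (6 * r + 5) dvd (i - e2 r s)"]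
    by (simp only: case_prod_unfold prod.collapse finite_cartesian_product finite_atMost)
  also have "card {(r, s) \<in> {..N} \<times> {..N}. e1 r s \<le> i \<and> (6 * r + 1) dvd (i - e1 r s)} =
      card {(a, b, c). a * b + 3 * (c * c) = 4 * (int i + 1) \<and> a > 0 \<and> c > 0 \<and> odd c \<and>
        a mod 6 = int 1 \<and> a + int 1 \<le> b}"
    by (rule card_lambert_exponents[OF _ _ _ assms]) (auto simp: e1_def algebra_simps)
  also have "card {(r, s) \<in> {..N} \<times> {..N}. e2 r s \<le> i \<and> (6 * r + 5) dvd (i - e2 r s)} =
      card {(a, b, c). a * b + 3 * (c * c) = 4 * (int i + 1) \<and> a > 0 \<and> c > 0 \<and> odd c \<and>
        a mod 6 = int 5 \<and> a + int 0 \<le> b}"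
    by (rule card_lambert_exponents[OF _ _ _ assms]) (auto simp: e2_def algebra_simps)
  also have "{(a, b, c). a * b + 3 * (c * c) = 4 * (int i + 1) \<and> a > 0 \<and> c > 0 \<and> odd c \<and>
        a mod 6 = int 1 \<and> a + int 1 \<le> b} = {t \<in> lambert_triples (int i + 1). fst t mod 6 = 1}"
    by (auto simp: lambert_triples_def)
  also have "{(a, b, c). a * b + 3 * (c * c) = 4 * (int i + 1) \<and> a > 0 \<and> c > 0 \<and> odd c \<and>
        a mod 6 = int 5 \<and> a + int 0 \<le> b} = {t \<in> lambert_triples (int i + 1). \<not> fst t mod 6 = 1}"
    by (auto simp: lambert_triples_def)
  finally show ?thesis
    using card_split[OF finite_lambert_triples, of "int i + 1" "\<lambda>t. fst t mod 6 = 1"] by simp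
qed

section \<open>Comparison with q^2 E^8\<close>

definition theta4 :: "nat \<Rightarrow> int fps" where
  "theta4 N = (\<Sum>s\<le>N. fps_X ^ (12 * (s * (s + 1)) + 2))"

lemma cong2_theta4: "cong2 M (fps_X\<^sup>2 * theta N ^ 4) (theta4 N)"
proof -
  have "theta N ^ 4 = ((theta N)\<^sup>2)\<^sup>2" by (simp flip: power_mult)
  also have "cong2 M \<dots> ((\<Sum>s\<le>N. (fps_X ^ (3 * (s * (s + 1))))\<^sup>2)\<^sup>2)"
    unfolding theta_def by (intro cong2_power cong2_square_sum)
  also have "cong2 M \<dots> (\<Sum>s\<le>N. ((fps_X ^ (3 * (s * (s + 1))))\<^sup>2)\<^sup>2)"
    by (rule cong2_square_sum)
  finally have "cong2 M (fps_X\<^sup>2 * theta N ^ 4) (fps_X\<^sup>2 * (\<Sum>s\<le>N. ((fps_X ^ (3 * (s * (s + 1))))\<^sup>2)\<^sup>2))"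
    by (intro cong2_mult cong2_refl)
  also have "fps_X\<^sup>2 * (\<Sum>s\<le>N. ((fps_X ^ (3 * (s * (s + 1))))\<^sup>2)\<^sup>2) = theta4 N"
    unfolding theta4_def sum_distrib_left
  proof (rule sum.cong[OF refl])
    fix s :: nat
    have "2 + 3 * (s * (s + 1)) * 2 * 2 = 12 * (s * (s + 1)) + 2" by simp
    then show "fps_X\<^sup>2 * ((fps_X ^ (3 * (s * (s + 1))))\<^sup>2)\<^sup>2 = (fps_X ^ (12 * (s * (s + 1)) + 2) :: int fps)"
      by (simp only: power_mult[symmetric] power_add[symmetric])
  qed
  finally show ?thesis .
qed

text \<open>i = 12 s (s + 1) + 2 says i + 1 = 3 (2 s + 1)^2, and the condition i mod 4 = 2 forces
  the root to be odd.\<close>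

lemma nth_theta4:
  assumes "i \<le> N"
  shows "fps_nth (theta4 N) i = of_bool (thrice_square (int i + 1) \<and> i mod 4 = 2)"
proof -
  have nth: "fps_nth (theta4 N) i = (\<Sum>s\<le>N. of_bool (i = 12 * (s * (s + 1)) + 2))"
    unfolding theta4_def fps_sum_nth fps_X_power_nth of_bool_def ..
  show ?thesis
  proof (cases "thrice_square (int i + 1) \<and> i mod 4 = 2")
    case True
    then obtain y where y: "y > 0" "3 * (y * y) = int i + 1" "i mod 4 = 2"
      by (auto simp: thrice_square_def)
    have "odd y"
    proof
      assume "even y"
      then have "y * y mod 4 = 0" by (simp add: square_mod_4)
      then show False using y(2,3) by presburger
    qed
    then obtain k where k: "y = 2 * k + 1" by (rule oddE)
    define s where "s = nat k"
    have ys: "y = 2 * int s + 1" using k y(1) by (simp add: s_def)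
    have "int (12 * (s * (s + 1)) + 2) = 3 * (y * y) - 1" unfolding ys by (simp add: algebra_simps)
    also have "\<dots> = int i" using y(2) by simp
    finally have s: "i = 12 * (s * (s + 1)) + 2" by (simp only: of_nat_eq_iff)
    have "(\<Sum>s'\<le>N. of_bool (i = 12 * (s' * (s' + 1)) + 2)) = (\<Sum>s'\<le>N. of_bool (s' = s) :: int)"
    proof (intro sum.cong refl)
      fix s' :: nat
      have "s' = s" if "s' * (s' + 1) = s * (s + 1)"
      proof (rule linorder_cases[of s' s])
        assume "s' < s"
        then have "s' * (s' + 1) < s * (s + 1)" by (intro mult_strict_mono) simp_all
        then show ?thesis using that by simp
      next
        assume "s < s'"
        then have "s * (s + 1) < s' * (s' + 1)" by (intro mult_strict_mono) simp_all
        then show ?thesis using that by simp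
      qed
      then have "i = 12 * (s' * (s' + 1)) + 2 \<longleftrightarrow> s' = s" unfolding s by auto
      then show "of_bool (i = 12 * (s' * (s' + 1)) + 2) = (of_bool (s' = s) :: int)" by simp
    qed
    also have "\<dots> = 1"
    proof -
      have "s \<le> N" using s assms by simp
      then show ?thesis by (simp add: of_bool_def)
    qed
    finally show ?thesis using True nth by simp
  next
    case False
    have "\<not> i = 12 * (s * (s + 1)) + 2" for s
    proof
      assume i: "i = 12 * (s * (s + 1)) + 2"
      have "3 * ((2 * int s + 1) * (2 * int s + 1)) = int i + 1" unfolding i by (simp add: algebra_simps)
      then have "thrice_square (int i + 1)"
        unfolding thrice_square_def by (intro exI[of _ "2 * int s + 1"]) simp
      moreover have "i mod 4 = 2" using i by presburger
      ultimately show False using False by simp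
    qed
    then show ?thesis using False nth by simp
  qed
qed

text \<open>Division by a series in q^4 with constant term 1 does not mix the residues mod 4 of the
  exponents.\<close>

lemma even_nth_of_mult:
  assumes "\<And>j. fps_nth F j \<noteq> 0 \<Longrightarrow> 4 dvd j" "fps_nth F 0 = 1"
    and "\<And>i. i \<le> N \<Longrightarrow> i mod 4 = 2 \<Longrightarrow> even (fps_nth (F * H) i)"
  shows "i \<le> N \<Longrightarrow> i mod 4 = 2 \<Longrightarrow> even (fps_nth H i :: int)"
proof (induction i rule: less_induct)
  case (less i)
  have "fps_nth (F * H) i = fps_nth H i + (\<Sum>j=1..i. fps_nth F j * fps_nth H (i - j))"
    unfolding fps_mult_nth using assms(2) by (subst sum.atLeast_Suc_atMost) simp_all
  moreover have "even (\<Sum>j=1..i. fps_nth F j * fps_nth H (i - j))"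
  proof (rule dvd_sum)
    fix j assume j: "j \<in> {1..i}"
    show "even (fps_nth F j * fps_nth H (i - j))"
    proof (cases "fps_nth F j = 0")
      case False
      then have "4 dvd j" by (rule assms(1))
      then obtain c where c: "j = 4 * c" by (rule dvdE)
      have "i mod 4 = (i - j + 4 * c) mod 4" using c j by simp
      then have "(i - j) mod 4 = 2" using less.prems(2) by (simp only: mod_mult_self2)
      then have "even (fps_nth H (i - j))" using j less.prems(1) by (intro less.IH) simp_all
      then show ?thesis by simp
    qed simp
  qed
  ultimately show ?case using assms(3)[OF less.prems] by (simp only: even_add)
qed

text \<open>Multiplied by E^4, the two parts of \<open>H\<close> become
  \<open>lambert N * theta N\<close> and q^2 (E^3)^4, whose coefficients at exponents 2 mod 4 have
  equal parity. Repeated squaring modulo 2 replaces E^4 and E^8 by the products in q^24 and q^48;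
  the former can be divided out, the latter has no term at i - 2.\<close>

lemma even_nth_xi_partial:
  assumes N: "i \<le> N" and i: "i mod 4 = 2" "\<not> 48 dvd i - 2"
  shows "even (fps_nth (fps_X * xi_partial N) i)"
proof -
  define M where "M = 6 * Suc N"
  define E where "E = euler_prod N 6"
  define G where "G = fps_X * xi_partial N"
  define H where "H = G - fps_X\<^sup>2 * E ^ 8"
  have EG: "cong2 M (E * G) (lambert N)" and E3: "cong2 M (E ^ 3) (theta N)"
    using cong2_xi_partial[of N] cong2_theta[of N] by (simp_all add: M_def E_def G_def)
  have pow: "E ^ 4 = E * E ^ 3" "E ^ 4 * E ^ 8 = (E ^ 3) ^ 4"
    by (simp_all flip: power_Suc power_mult power_add)
  have "cong2 M (E ^ 3 * (E * G)) (theta N * lambert N)"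
    by (rule cong2_mult[OF E3 EG])
  then have 1: "cong2 M (E ^ 4 * G) (lambert N * theta N)"
    unfolding pow by (simp only: mult_ac)
  have "cong2 M (fps_X\<^sup>2 * (E ^ 3) ^ 4) (theta4 N)"
    by (rule cong2_trans[OF cong2_mult[OF cong2_refl cong2_power[OF E3]] cong2_theta4])
  then have 2: "cong2 M (E ^ 4 * (fps_X\<^sup>2 * E ^ 8)) (theta4 N)"
    unfolding pow(2)[symmetric] by (simp only: mult_ac)
  have E2: "cong2 M (E\<^sup>2) (euler_prod N 12)"
    using cong2_euler_prod_square[of M N 6] by (simp add: E_def)
  have "cong2 M ((E\<^sup>2)\<^sup>2) (euler_prod N 24)"
    using cong2_trans[OF cong2_power[OF E2] cong2_euler_prod_square] by simp
  then have E4: "cong2 M (E ^ 4) (euler_prod N 24)" by (simp flip: power_mult)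
  have "cong2 M ((E ^ 4)\<^sup>2) (euler_prod N 48)"
    using cong2_trans[OF cong2_power[OF E4] cong2_euler_prod_square] by simp
  then have E8: "cong2 M (E ^ 8) (euler_prod N 48)" by (simp flip: power_mult)
  have "even (fps_nth (euler_prod N 24 * H) m)" if m: "m \<le> N" "m mod 4 = 2" for m
  proof -
    have "m < M" using m by (simp add: M_def)
    have "even (fps_nth (euler_prod N 24 * H) m) \<longleftrightarrow> even (fps_nth (E ^ 4 * H) m)"
      by (rule cong2_nth[OF cong2_mult[OF cong2_sym[OF E4] cong2_refl] \<open>m < M\<close>])
    also have "fps_nth (E ^ 4 * H) m = fps_nth (E ^ 4 * G) m - fps_nth (E ^ 4 * (fps_X\<^sup>2 * E ^ 8)) m"
      by (simp only: H_def right_diff_distrib fps_sub_nth)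
    also have "even \<dots> \<longleftrightarrow> (even (int (card (lambert_triples (int m + 1)))) \<longleftrightarrow>
        even (of_bool (thrice_square (int m + 1) \<and> m mod 4 = 2) :: int))"
      using cong2_nth[OF 1 \<open>m < M\<close>] cong2_nth[OF 2 \<open>m < M\<close>]
      unfolding nth_lambert_theta[OF m(1)] nth_theta4[OF m(1)] by auto
    also have "\<dots>"
    proof -
      have "(int m + 1) mod 4 = 3" using m(2) by presburger
      then show ?thesis using odd_card_lambert_triples[of "int m + 1"] m(2) by auto
    qed
    finally show ?thesis by blast
  qed
  then have "even (fps_nth H i)"
  proof (rule even_nth_of_mult[where F = "euler_prod N 24" and N = N, rotated 2])
    show "4 dvd j" if "fps_nth (euler_prod N 24) j \<noteq> 0" for j
    proof -
      have "24 dvd j" using that euler_prod_nth by blast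
      then show ?thesis by presburger
    qed
  qed (use N i in \<open>simp_all add: euler_prod_nth_0\<close>)
  moreover have "even (fps_nth (fps_X\<^sup>2 * E ^ 8) i)"
  proof -
    have "i < M" using N by (simp add: M_def)
    then have "even (fps_nth (fps_X\<^sup>2 * E ^ 8) i) \<longleftrightarrow> even (fps_nth (fps_X\<^sup>2 * euler_prod N 48) i)"
      by (rule cong2_nth[OF cong2_mult[OF cong2_refl E8]])
    moreover have "fps_nth (fps_X\<^sup>2 * euler_prod N 48) i = 0"
    proof -
      have "i \<ge> 2" using i(1) by presburger
      then show ?thesis using i(2) by (simp add: fps_X_power_mult_nth euler_prod_nth)
    qed
    ultimately show ?thesis by simp
  qed
  ultimately have "even (fps_nth H i + fps_nth (fps_X\<^sup>2 * E ^ 8) i)" by simp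
  then show ?thesis by (simp add: H_def G_def)
qed

theorem theorem5p2:
  fixes n :: nat
  shows "[p_xi (8 * n + 6) = 0] (mod 4) \<and> [p_xi (16 * n + 10) = 0] (mod 4)"
proof -
  \<comment> \<open>Both progressions avoid the class 2 mod 48: m - 2 is 4 mod 8 for the first and 8
    mod 16 for the second.\<close>
  have *: "[p_xi m = 0] (mod 4)" if m: "m mod 4 = 2" "\<not> 48 dvd m - 2" for m
  proof -
    have "m > 0" using m by (cases m) simp_all
    obtain k where "fps_nth (fps_X * xi_partial m) m = 2 * k"
      using even_nth_xi_partial[OF order_refl m] by (rule evenE)
    then have "p_xi m = 4 * k" using p_xi_eq[OF \<open>m > 0\<close>] by simp
    then show ?thesis by (simp add: cong_def)
  qed
  have "\<not> 8 dvd 8 * n + 4" "\<not> 16 dvd 16 * n + 8" by presburger+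
  moreover have "8 dvd k" "16 dvd k" if "48 dvd k" for k :: nat
    using that by (auto intro: dvd_trans[of _ 48])
  ultimately have "\<not> 48 dvd 8 * n + 4" "\<not> 48 dvd 16 * n + 8" by blast+
  moreover have "8 * n + 6 - 2 = 8 * n + 4" "16 * n + 10 - 2 = 16 * n + 8" by simp_all
  ultimately have "\<not> 48 dvd 8 * n + 6 - 2" "\<not> 48 dvd 16 * n + 10 - 2" by metis+
  moreover have "(8 * n + 6) mod 4 = 2" "(16 * n + 10) mod 4 = 2" by presburger+
  ultimately show ?thesis using * by blast
qed

end
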